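(* Let $d\in\mathbb{N}$, $m>0$, $T>0$. Let $\mathbf{v}_0\in C^1(\mathbb{R}^d;\mathbb{R}^d)$ satisfy $\mathrm{D}\mathbf{v}_0\in L^\infty(\mathbb{R}^d;\mathbb{R}^{d\times d})$ and $\mathbf{v}_0=\nabla\varphi_0$ for some $\varphi_0\in C^2(\mathbb{R}^d)$, and set $\theta_0:=m\varphi_0+c_0$ for some $c_0\in\mathbb{R}$. Let $\rho_0\colon\mathbb{R}^d\to\mathbb{R}_{>0}$ be a probability density with $\mu_0:=\rho_0\,\mathrm{d}x\in\mathcal{P}_2(\mathbb{R}^d)$. Assume that: (1) the free Madelung problem (see context) with initial data $(\rho_0,\theta_0)$ admits a unique classical solution $(\rho^{\theta_0},\theta^{\theta_0})\colon\mathbb{R}^d\times[0,T]\to\mathbb{R}_{\ge0}\times\mathbb{R}$ satisfying $$(\rho^{\theta_0},\theta^{\theta_0})\in\big[C^1([0,T];C^0_{\mathrm{loc}}(\mathbb{R}^d))\cap C^0([0,T];C^2_{\mathrm{loc}}(\mathbb{R}^d))\big]^2,$$ and $\rho^{\theta_0}(\cdot,t)$ is a probability density for all $t\in[0,T]$; (2) $\rho^{\theta_0}(x,t)>0$ for all $(x,t)\in\mathbb{R}^d\times[0,T]$; (3) $(\rho^{\theta_0},\theta^{\theta_0})\in C^0([0,T];C^3_{\mathrm{loc}}(\mathbb{R}^d))\times C^1([0,T];C^1_{\mathrm{loc}}(\mathbb{R}^d))$; (4) the velocity field $\mathbf{v}^{\theta_0}:=\frac1m\nabla\theta^{\theta_0}$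 satisfies, for some constants $L_T,C_T>0$, $|\mathbf{v}^{\theta_0}(x,t)-\mathbf{v}^{\theta_0}(y,t)|\le L_T|x-y|$ for all $x,y\in\mathbb{R}^d$, $t\in[0,T]$, and $|\mathbf{v}^{\theta_0}(x,t)|\le C_T(1+|x|)$ for all $(x,t)\in\mathbb{R}^d\times[0,T]$; (5) the material acceleration $\mathbf{a}^{\theta_0}$ (see context) satisfies $\mathbf{a}^{\theta_0}\in L^\infty(\mathbb{R}^d\times(0,T);\mathbb{R}^d)$. Let $X^{\theta_0}\colon[0,T]\times\mathbb{R}^d\to\mathbb{R}^d$ be the characteristic flow generated by $\mathbf{v}^{\theta_0}$, and let $$\widetilde X_T^{\theta_0}(x):=x+T\mathbf{v}_0(x)\quad(x\in\mathbb{R}^d),\qquad \widetilde\mu_T^{\theta_0}:=[\widetilde X_T^{\theta_0}]_{\#}\mu_0 .$$ Then, for every $x\in\mathbb{R}^d$, $$X^{\theta_0}(T;x)-\widetilde X_T^{\theta_0}(x)=\int_0^T(T-t)\,\mathbf{a}^{\theta_0}(X^{\theta_0}(t;x),t)\,\mathrm{d}t,$$ and, consequently, $$\|X^{\theta_0}(T;\cdot)-\widetilde X_T^{\theta_0}\|_{L^\infty(\mathbb{R}^d;\mathbb{R}^d)}\le\frac{T^2}{2}\,\|\mathbf{a}^{\theta_0}\|_{L^\infty(\mathbb{R}^d\times(0,T);\mathbb{R}^d)}.$$ Moreover, setting $\mu_T^{\theta_0}:=\rho^{\theta_0}(\cdot,T)\,\mathrm{d}x=[X^{\theta_0}(T;\cdot)]_{\#}\mu_0\in\mathcal{P}_2(\mathbb{R}^d)$,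 for every $p\in\{1,2\}$, $$W_p(\mu_T^{\theta_0},\widetilde\mu_T^{\theta_0})\le\frac{T^2}{2}\,\|\mathbf{a}^{\theta_0}\|_{L^\infty(\mathbb{R}^d\times(0,T);\mathbb{R}^d)}.$$
   Context: A probability density on $\mathbb{R}^d$ is a function $f\colon\mathbb{R}^d\to\mathbb{R}_{\ge0}$ with $\|f\|_{L^1(\mathbb{R}^d)}=1$; $f\,\mathrm{d}x$ is the Borel probability measure with Lebesgue density $f$. $F_{\#}\mu$ denotes the pushforward. For positive sufficiently regular $\rho$, the Bohm quantum potential (units $\hbar=1$) is $Q_{\mathrm{B}}(\rho):=-\frac{1}{2m}\frac{\Delta\sqrt{\rho}}{\sqrt{\rho}}$. The free Madelung problem with initial data $(\rho_0,\theta_0)$ is $$\partial_t\rho+\tfrac1m\operatorname{div}(\rho\nabla\theta)=0\ \text{ in }\mathbb{R}^d\times(0,T),\qquad \partial_t\theta+\tfrac{1}{2m}|\nabla\theta|^2+Q_{\mathrm{B}}(\rho)=0\ \text{ in }\mathbb{R}^d\times(0,T),$$ $$\rho(\cdot,0)=\rho_0,\qquad\theta(\cdot,0)=\theta_0\ \text{ in }\mathbb{R}^d,$$ with $\nabla,\operatorname{div},\Delta$ (and $\mathrm{D}$, the Jacobian) acting in the spatial variable. The space $C^k([0,T];C^l_{\mathrm{loc}}(\mathbb{R}^d))$ consists of functions $f$ on $\mathbb{R}^d\times[0,T]$ such that for every compact set (e.g. closed ball) $K\subset\mathbb{R}^d$ the map $t\mapsto f(\cdot,t)|_K$ belongs to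 $C^k([0,T];C^l(K))$. The characteristic flow generated by $\mathbf{v}^{\theta_0}$ is the unique solution of $\partial_tX^{\theta_0}(t;x)=\mathbf{v}^{\theta_0}(X^{\theta_0}(t;x),t)$ for $(t,x)\in(0,T)\times\mathbb{R}^d$, $X^{\theta_0}(0;x)=x$ for $x\in\mathbb{R}^d$. The material acceleration $\mathbf{a}^{\theta_0}\colon\mathbb{R}^d\times(0,T)\to\mathbb{R}^d$ is $$\mathbf{a}^{\theta_0}:=\partial_t\mathbf{v}^{\theta_0}+[\mathrm{D}\mathbf{v}^{\theta_0}]\mathbf{v}^{\theta_0}\;\Big(=-\tfrac1m\nabla Q_{\mathrm{B}}(\rho^{\theta_0})\Big).$$ For $p\in[1,\infty)$, $\mathcal{P}_p(\mathbb{R}^d)$ is the set of Borel probability measures $\mu$ on $\mathbb{R}^d$ with $\int|x|^p\,\mathrm{d}\mu(x)<\infty$, and for $\mu,\nu\in\mathcal{P}_p(\mathbb{R}^d)$ the $p$-Wasserstein distance is $W_p(\mu,\nu):=\inf_{\pi\in\Pi(\mu,\nu)}\big(\int_{\mathbb{R}^d\times\mathbb{R}^d}|x-y|^p\,\mathrm{d}\pi(x,y)\big)^{1/p}$, where $\Pi(\mu,\nu)$ is the set of couplings of $\mu$ and $\nu$. *)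

theory Defs
  imports "HOL-Probability.Probability"
begin

section \<open>Spatial derivatives\<close>

definition partial :: "'n \<Rightarrow> (real^'n \<Rightarrow> real) \<Rightarrow> real^'n \<Rightarrow> real" where
  "partial i f x = frechet_derivative f (at x) (axis i 1)"

text \<open>Multi-indices are encoded as lists of coordinate directions, the length being the order.\<close>

primrec partials :: "'n list \<Rightarrow> (real^'n \<Rightarrow> real) \<Rightarrow> real^'n \<Rightarrow> real" where
  "partials [] f = f"
| "partials (i # is) f = partial i (partials is f)"

definition grad :: "(real^'n \<Rightarrow> real) \<Rightarrow> real^'n \<Rightarrow> real^'n" where
  "grad f x = (\<chi> i. partial i f x)"

definition divergence :: "(real^'n \<Rightarrow> real^'n) \<Rightarrow> real^'n \<Rightarrow> real" where
  "divergence F x = (\<Sum>i\<in>UNIV. partial i (\<lambda>y. F y $ i) x)"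

definition laplacian :: "(real^'n \<Rightarrow> real) \<Rightarrow> real^'n \<Rightarrow> real" where
  "laplacian f x = (\<Sum>i\<in>UNIV. partial i (partial i f) x)"


section \<open>Function spaces\<close>

definition C_space :: "nat \<Rightarrow> (real^'n \<Rightarrow> real) set" where
  "C_space l = {f.
     (\<forall>is. length is \<le> l \<longrightarrow> continuous_on UNIV (partials is f)) \<and>
     (\<forall>is. length is < l \<longrightarrow> (\<forall>x. partials is f differentiable (at x)))}"

definition C_space_vec :: "nat \<Rightarrow> (real^'n \<Rightarrow> real^'n) set" where
  "C_space_vec l = {F. \<forall>i. (\<lambda>x. F x $ i) \<in> C_space l}"

text \<open>Convergence in the norm of \<open>C\<^sup>l(K)\<close>: all partial derivatives of order at most \<open>l\<close>
  converge uniformly on \<open>K\<close>.\<close>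

definition C_converges ::
  "nat \<Rightarrow> (real^'n) set \<Rightarrow> ('a \<Rightarrow> real^'n \<Rightarrow> real) \<Rightarrow> (real^'n \<Rightarrow> real) \<Rightarrow> 'a filter \<Rightarrow> bool" where
  "C_converges l K u w F \<longleftrightarrow>
     (\<forall>is. length is \<le> l \<longrightarrow> uniform_limit K (\<lambda>s. partials is (u s)) (partials is w) F)"

text \<open>\<open>CC_loc k l T\<close> is the space \<open>C\<^sup>k([0,T]; C\<^sup>l\<^sub>l\<^sub>o\<^sub>c)\<close>; the function takes the space
  variable first. The time derivative \<open>g\<close> is the limit of difference quotients in \<open>C\<^sup>l(K)\<close>
  for every compact \<open>K\<close>, one-sided at the end points of \<open>[0,T]\<close>. Membership only depends on
  the values at times in \<open>[0,T]\<close>.\<close>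

primrec CC_loc :: "nat \<Rightarrow> nat \<Rightarrow> real \<Rightarrow> (real^'n \<Rightarrow> real \<Rightarrow> real) set" where
  "CC_loc 0 l T = {f.
     (\<forall>t\<in>{0..T}. (\<lambda>x. f x t) \<in> C_space l) \<and>
     (\<forall>K. compact K \<longrightarrow> (\<forall>t\<in>{0..T}.
        C_converges l K (\<lambda>s x. f x s) (\<lambda>x. f x t) (at t within {0..T})))}"
| "CC_loc (Suc k) l T = {f.
     (\<forall>t\<in>{0..T}. (\<lambda>x. f x t) \<in> C_space l) \<and>
     (\<exists>g\<in>CC_loc k l T. \<forall>K. compact K \<longrightarrow> (\<forall>t\<in>{0..T}.
        C_converges l K (\<lambda>s x. (f x s - f x t) / (s - t)) (\<lambda>x. g x t) (at t within {0..T})))}"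

text \<open>The norm of \<open>L\<^sup>\<infinity>\<close>. It is \<open>\<infinity>\<close> when the norm of the function is not measurable,
  as is the library's \<^const>\<open>esssup\<close>.\<close>

definition Linf_norm :: "'a measure \<Rightarrow> ('a \<Rightarrow> 'b::real_normed_vector) \<Rightarrow> ennreal" where
  "Linf_norm M f = esssup M (\<lambda>x. ennreal (norm (f x)))"

definition Linf :: "'a measure \<Rightarrow> ('a \<Rightarrow> 'b::real_normed_vector) set" where
  "Linf M = {f. f \<in> borel_measurable M \<and> Linf_norm M f < \<infinity>}"

definition prob_density :: "(real^'n \<Rightarrow> real) \<Rightarrow> bool" where
  "prob_density f \<longleftrightarrow>
     f \<in> borel_measurable borel \<and> (\<forall>x. 0 \<le> f x) \<and> (\<integral>\<^sup>+x. ennreal \<bar>f x\<bar> \<partial>lborel) = 1"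

definition density_measure :: "(real^'n \<Rightarrow> real) \<Rightarrow> (real^'n) measure" where
  "density_measure f = density lborel (\<lambda>x. ennreal (f x))"


section \<open>The free Madelung problem\<close>

definition bohm_potential :: "real \<Rightarrow> (real^'n \<Rightarrow> real) \<Rightarrow> real^'n \<Rightarrow> real" where
  "bohm_potential m \<rho> x = - (1 / (2 * m)) * (laplacian (\<lambda>y. sqrt (\<rho> y)) x / sqrt (\<rho> x))"

text \<open>The quantum potential is only defined for positive densities, so the equation for \<open>\<theta>\<close>
  comprises the requirement \<open>\<rho> > 0\<close> on \<open>(0,T)\<close>; otherwise division by zero would
  give it an unintended meaning.\<close>

definition madelung_equations ::
  "real \<Rightarrow> real \<Rightarrow> (real^'n \<Rightarrow> real) \<Rightarrow> (real^'n \<Rightarrow> real) \<Rightarrow>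
   (real^'n \<Rightarrow> real \<Rightarrow> real) \<Rightarrow> (real^'n \<Rightarrow> real \<Rightarrow> real) \<Rightarrow> bool" where
  "madelung_equations m T \<rho>0 \<theta>0 \<rho> \<theta> \<longleftrightarrow>
     (\<forall>x. \<forall>t\<in>{0<..<T}.
        deriv (\<lambda>s. \<rho> x s) t
          + (1 / m) * divergence (\<lambda>y. \<rho> y t *\<^sub>R grad (\<lambda>z. \<theta> z t) y) x = 0) \<and>
     (\<forall>x. \<forall>t\<in>{0<..<T}. \<rho> x t > 0 \<and>
        deriv (\<lambda>s. \<theta> x s) t
          + (1 / (2 * m)) * (norm (grad (\<lambda>y. \<theta> y t) x))\<^sup>2
          + bohm_potential m (\<lambda>y. \<rho> y t) x = 0) \<and>
     (\<forall>x. \<rho> x 0 = \<rho>0 x \<and> \<theta> x 0 = \<theta>0 x)"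

definition madelung_solution ::
  "real \<Rightarrow> real \<Rightarrow> (real^'n \<Rightarrow> real) \<Rightarrow> (real^'n \<Rightarrow> real) \<Rightarrow>
   (real^'n \<Rightarrow> real \<Rightarrow> real) \<Rightarrow> (real^'n \<Rightarrow> real \<Rightarrow> real) \<Rightarrow> bool" where
  "madelung_solution m T \<rho>0 \<theta>0 \<rho> \<theta> \<longleftrightarrow>
     (\<forall>x. \<forall>t\<in>{0..T}. \<rho> x t \<ge> 0) \<and>
     \<rho> \<in> CC_loc 1 0 T \<inter> CC_loc 0 2 T \<and>
     \<theta> \<in> CC_loc 1 0 T \<inter> CC_loc 0 2 T \<and>
     (\<forall>t\<in>{0..T}. prob_density (\<lambda>x. \<rho> x t)) \<and>
     madelung_equations m T \<rho>0 \<theta>0 \<rho> \<theta>"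

definition unique_madelung_solution ::
  "real \<Rightarrow> real \<Rightarrow> (real^'n \<Rightarrow> real) \<Rightarrow> (real^'n \<Rightarrow> real) \<Rightarrow>
   (real^'n \<Rightarrow> real \<Rightarrow> real) \<Rightarrow> (real^'n \<Rightarrow> real \<Rightarrow> real) \<Rightarrow> bool" where
  "unique_madelung_solution m T \<rho>0 \<theta>0 \<rho> \<theta> \<longleftrightarrow>
     madelung_solution m T \<rho>0 \<theta>0 \<rho> \<theta> \<and>
     (\<forall>\<rho>' \<theta>'. madelung_solution m T \<rho>0 \<theta>0 \<rho>' \<theta>' \<longrightarrow>
        (\<forall>x. \<forall>t\<in>{0..T}. \<rho>' x t = \<rho> x t \<and> \<theta>' x t = \<theta> x t))"

definition velocity :: "real \<Rightarrow> (real^'n \<Rightarrow> real \<Rightarrow> real) \<Rightarrow> real^'n \<Rightarrow> real \<Rightarrow> real^'n" where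
  "velocity m \<theta> x t = (1 / m) *\<^sub>R grad (\<lambda>y. \<theta> y t) x"

definition material_acceleration ::
  "(real^'n \<Rightarrow> real \<Rightarrow> real^'n) \<Rightarrow> real^'n \<Rightarrow> real \<Rightarrow> real^'n" where
  "material_acceleration v x t =
     vector_derivative (\<lambda>s. v x s) (at t) + jacobian (\<lambda>y. v y t) (at x) *v v x t"

definition characteristic_flow ::
  "real \<Rightarrow> (real^'n \<Rightarrow> real \<Rightarrow> real^'n) \<Rightarrow> (real \<Rightarrow> real^'n \<Rightarrow> real^'n) \<Rightarrow> bool" where
  "characteristic_flow T v X \<longleftrightarrow> (\<forall>x.
     X 0 x = x \<and>
     continuous_on {0..T} (\<lambda>t. X t x) \<and>
     (\<forall>t\<in>{0<..<T}. ((\<lambda>s. X s x) has_vector_derivative v (X t x) t) (at t)))"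


section \<open>Wasserstein distance\<close>

definition P_space :: "real \<Rightarrow> (real^'n) measure set" where
  "P_space p = {\<mu>. sets \<mu> = sets borel \<and> prob_space \<mu> \<and>
     (\<integral>\<^sup>+x. ennreal (norm x powr p) \<partial>\<mu>) < \<infinity>}"

definition couplings ::
  "(real^'n) measure \<Rightarrow> (real^'n) measure \<Rightarrow> ((real^'n) \<times> (real^'n)) measure set" where
  "couplings \<mu> \<nu> = {\<pi>. sets \<pi> = sets borel \<and> prob_space \<pi> \<and>
     distr \<pi> borel fst = \<mu> \<and> distr \<pi> borel snd = \<nu>}"

definition ennreal_root :: "real \<Rightarrow> ennreal \<Rightarrow> ennreal" where
  "ennreal_root p c = (if c = \<infinity> then \<infinity> else ennreal (enn2real c powr (1 / p)))"

text \<open>Taken in \<open>[0,\<infinity>]\<close>, so that the formula needs no finiteness side conditions; on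
  \<^const>\<open>P_space\<close> it is the usual finite distance.\<close>

definition wasserstein :: "real \<Rightarrow> (real^'n) measure \<Rightarrow> (real^'n) measure \<Rightarrow> ennreal" where
  "wasserstein p \<mu> \<nu> =
     (INF \<pi>\<in>couplings \<mu> \<nu>. ennreal_root p (\<integral>\<^sup>+z. ennreal (norm (fst z - snd z) powr p) \<partial>\<pi>))"

end

theory Submission
  imports Defs
begin

text \<open>Along a characteristic, \<open>t \<mapsto> v(X(t), t)\<close> has derivative \<open>a(X(t), t)\<close>, so
  \<open>t \<mapsto> X(t) + (T - t) v(X(t), t)\<close> has derivative \<open>(T - t) a(X(t), t)\<close>; integrating over
  \<open>[0,T]\<close> gives the error formula, and the bounds on the flow and on the Wasserstein distance
  follow with the coupling \<open>(X\<^sub>T, x + T v\<^sub>0)\<^sub># \<mu>\<^sub>0\<close>.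

  That \<open>\<rho>(\<cdot>, T) dx\<close> is the image of \<open>\<mu>\<^sub>0\<close> under \<open>X\<^sub>T\<close> is shown by duality, without
  differentiating the flow in the initial point. For a Lipschitz test function \<open>\<psi>\<close> with bounded
  support, \<open>\<psi>\<^sub>t = \<psi> \<circ> X\<^sub>T \<circ> inv X\<^sub>t\<close> is Lipschitz with bounded support, uniformly in \<open>t\<close>.
  To see that \<open>F(t) = \<integral> \<psi>\<^sub>t \<rho>\<^sub>t\<close> has derivative \<open>0\<close>, one substitutes the explicit diffeomorphism
  \<open>E(x) = x + h v(x, t)\<close> in \<open>F(t + h)\<close>: it differs from the flow over the time \<open>h\<close> by \<open>O(h\<^sup>2)\<close>,
  and \<open>\<rho>(E(x), t + h) det(DE(x)) - \<rho>(x, t) = o(h)\<close> locally uniformly by the continuity equation.\<close>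


section \<open>Change of variables\<close>

text \<open>The map \<open>X T\<close> is only known to be bi-Lipschitz, so it offers no Jacobian
  and the transported test functions are no better than Lipschitz. The derivatives are therefore put
  on the density and on \<open>E\<close>, whose Jacobian matrix \<open>mat 1 + h A\<close> is
  explicit once \<open>A\<close>, the Jacobian of the velocity, is known. The quadratic error of
  \<open>E\<close> comes from the bounded acceleration, which makes the velocity Lipschitz in time
  along each characteristic; test functions constant along characteristics turn it into a quadratic
  error of the integrand, weighted by a density of mass one. Bounded support confines the other
  error to a compact set, where local uniformity suffices. Two gaps in the data must be closed
  first. An essential bound on the acceleration says nothing about one characteristic, a null set in
  space-time, so continuity upgrades it to a pointwise bound. The equations hold only on the open
  time interval, so the continuity equation is extended to the end times by continuity before
  \<open>F\<close> is differentiated on \<open>[0,T]\<close>.\<close>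

text \<open>The library states the change of variables formula only for index types of class
  \<^class>\<open>wellorder\<close>; a well-ordered copy of an arbitrary finite index type removes this
  restriction.\<close>

typedef 'a wo_index = "UNIV :: 'a set"
  morphisms un_wo to_wo by simp

instance wo_index :: (finite) finite
proof
  have "range to_wo = (UNIV :: 'a wo_index set)"
    by (metis un_wo_inverse surj_def)
  then show "finite (UNIV :: 'a wo_index set)"
    by (metis finite finite_imageI)
qed

lemma un_wo_to_wo [simp]: "un_wo (to_wo i) = i"
  by (simp add: to_wo_inverse)

lemma bij_un_wo: "bij un_wo"
  by (metis un_wo_inverse un_wo_to_wo bijI')

instantiation wo_index :: (finite) wellorder
begin

definition less_eq_wo_index :: "'a wo_index \<Rightarrow> 'a wo_index \<Rightarrow> bool" where
  "less_eq_wo_index i j \<longleftrightarrow> to_nat_on UNIV (un_wo i) \<le> to_nat_on UNIV (un_wo j)"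

definition less_wo_index :: "'a wo_index \<Rightarrow> 'a wo_index \<Rightarrow> bool" where
  "less_wo_index i j \<longleftrightarrow> to_nat_on UNIV (un_wo i) < to_nat_on UNIV (un_wo j)"

instance
proof
  have inj: "to_nat_on UNIV (un_wo i) = to_nat_on UNIV (un_wo j) \<longleftrightarrow> i = j" for i j :: "'a wo_index"
    by (simp add: countable_finite un_wo_inject)
  fix i j k :: "'a wo_index"
  show "i < j \<longleftrightarrow> i \<le> j \<and> \<not> j \<le> i" "i \<le> i" "i \<le> j \<or> j \<le> i"
    "i \<le> j \<Longrightarrow> j \<le> k \<Longrightarrow> i \<le> k"
    by (auto simp: less_eq_wo_index_def less_wo_index_def)
  show "i \<le> j \<Longrightarrow> j \<le> i \<Longrightarrow> i = j"
    by (auto simp: less_eq_wo_index_def inj[symmetric])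
  fix P :: "'a wo_index \<Rightarrow> bool"
  assume *: "\<And>i. (\<And>j. j < i \<Longrightarrow> P j) \<Longrightarrow> P i"
  show "P i"
    by (induction "to_nat_on UNIV (un_wo i)" arbitrary: i rule: less_induct)
       (metis * less_wo_index_def)
qed

end

text \<open>Conjugation by \<open>f\<close> is a sign-preserving bijection between the permutations
  of the two index types and matches the Leibniz sums term by term. It is needed because relabelling
  coordinates conjugates the Jacobian matrix.\<close>

lemma det_reindex:
  fixes A :: "'b::comm_ring_1^'n::finite^'n" and f :: "'k::finite \<Rightarrow> 'n"
  assumes f: "bij f"
  shows "det (\<chi> i j. A $ f i $ f j) = det A"
proof -
  have inj: "inj f" and surj: "f ` UNIV = UNIV"
    using f by (auto simp: bij_def)
  have bij: "bij_betw (map_permutation UNIV f) {p. p permutes UNIV} {p. p permutes (UNIV :: 'n set)}"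
  proof -
    have bf: "bij_betw f UNIV UNIV"
      using f by simp
    have bi: "bij_betw (inv f) UNIV UNIV"
      using f bij_imp_bij_inv by blast
    show ?thesis
    proof (rule bij_betw_byWitness[where f' = "map_permutation UNIV (inv f)"])
      have e: "map_permutation (f ` UNIV) (inv f) (map_permutation UNIV f p) = p" if "p permutes UNIV" for p
        using map_permutation_compose_inv[OF bf that, of "inv f"] surj inj by simp
      show "\<forall>p\<in>{p. p permutes UNIV}. map_permutation UNIV (inv f) (map_permutation UNIV f p) = p"
        using e surj by auto
      have "map_permutation UNIV f (map_permutation UNIV (inv f) p) = p" if "p permutes UNIV" for p
        using map_permutation_compose_inv[OF bi that, of f] surj by (simp add: surj_f_inv_f)
      then show "\<forall>p\<in>{p. p permutes UNIV}. map_permutation UNIV f (map_permutation UNIV (inv f) p) = p"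
        by auto
      show "map_permutation UNIV f ` {p. p permutes UNIV} \<subseteq> {p. p permutes UNIV}"
        using map_permutation_permutes[OF bf] by auto
      show "map_permutation UNIV (inv f) ` {p. p permutes UNIV} \<subseteq> {p. p permutes UNIV}"
        using map_permutation_permutes[OF bi] by auto
    qed
  qed
  have "det A = (\<Sum>p | p permutes UNIV. of_int (sign (map_permutation UNIV f p)) *
                   (\<Prod>i\<in>UNIV. A $ i $ map_permutation UNIV f p i))"
    unfolding det_def by (rule sum.reindex_bij_betw[OF bij, symmetric])
  also have "\<dots> = (\<Sum>p | p permutes UNIV. of_int (sign p) * (\<Prod>i\<in>UNIV. A $ f i $ f (p i)))"
  proof (rule sum.cong[OF refl])
    fix p :: "'k \<Rightarrow> 'k"
    assume "p \<in> {p. p permutes UNIV}"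
    then have p: "p permutes UNIV" by simp
    have "(\<Prod>i\<in>UNIV. A $ i $ map_permutation UNIV f p i)
        = (\<Prod>i\<in>UNIV. A $ f i $ map_permutation UNIV f p (f i))"
      by (rule prod.reindex_bij_betw[OF f, symmetric])
    then show "of_int (sign (map_permutation UNIV f p)) * (\<Prod>i\<in>UNIV. A $ i $ map_permutation UNIV f p i)
         = of_int (sign p) * (\<Prod>i\<in>UNIV. A $ f i $ f (p i))"
      using inj p by (simp add: sign_map_permutation map_permutation_apply)
  qed
  finally show ?thesis
    by (simp add: det_def)
qed

section \<open>Relabelling of coordinates and Lebesgue measure\<close>

definition wo_vec :: "'a^'n \<Rightarrow> 'a^('n wo_index)" where
  "wo_vec x = (\<chi> i. x $ un_wo i)"

definition un_wo_vec :: "'a^('n wo_index) \<Rightarrow> 'a^'n" where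
  "un_wo_vec x = (\<chi> i. x $ to_wo i)"

lemma wo_vec_inverse [simp]: "un_wo_vec (wo_vec x) = x" "wo_vec (un_wo_vec y) = y"
  by (simp_all add: wo_vec_def un_wo_vec_def vec_eq_iff un_wo_inverse)

lemma bounded_linear_wo_vec: "bounded_linear (wo_vec :: real^'n \<Rightarrow> _)"
  by (intro linear_conv_bounded_linear[THEN iffD1] linearI) (simp_all add: wo_vec_def vec_eq_iff)

lemma bounded_linear_un_wo_vec: "bounded_linear (un_wo_vec :: _ \<Rightarrow> real^'n)"
  by (intro linear_conv_bounded_linear[THEN iffD1] linearI) (simp_all add: un_wo_vec_def vec_eq_iff)

lemma measurable_un_wo_vec [measurable]: "(un_wo_vec :: _ \<Rightarrow> real^'n) \<in> borel \<rightarrow>\<^sub>M borel"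
  by (intro borel_measurable_continuous_onI linear_continuous_on bounded_linear_un_wo_vec)

text \<open>Relabelling maps boxes to boxes with the same side lengths in another order, and the
  volumes of boxes determine Lebesgue measure.\<close>

lemma lborel_un_wo_vec: "distr lborel borel un_wo_vec = (lborel :: (real^'n) measure)"
proof (rule lborel_eqI[symmetric])
  fix l u :: "real^'n"
  assume le: "\<And>b. b \<in> Basis \<Longrightarrow> l \<bullet> b \<le> u \<bullet> b"
  have le': "l $ i \<le> u $ i" for i
    using le[of "axis i 1"] by (simp add: axis_in_Basis_iff inner_axis)
  have *: "(\<Prod>b\<in>Basis. f \<bullet> b) = (\<Prod>i\<in>UNIV. f $ i)" for f :: "real^'k::finite"
  proof -
    have B: "Basis = range (\<lambda>i. axis i 1 :: real^'k)"
      by (auto simp: Basis_vec_def)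
    have "inj (\<lambda>i. axis i 1 :: real^'k)"
      by (auto simp: inj_on_def axis_eq_axis)
    then have "(\<Prod>b\<in>Basis. f \<bullet> b) = (\<Prod>i\<in>UNIV. f \<bullet> axis i 1)"
      unfolding B by (rule prod.reindex[unfolded o_def])
    then show ?thesis
      by (simp add: inner_axis)
  qed
  have "un_wo_vec -` box l u = box (wo_vec l) (wo_vec u)"
    unfolding mem_box_cart un_wo_vec_def wo_vec_def set_eq_iff vimage_def
    by simp (metis un_wo_inverse un_wo_to_wo)
  then have "emeasure (distr lborel borel un_wo_vec) (box l u) = emeasure lborel (box (wo_vec l) (wo_vec u))"
    by (simp add: emeasure_distr)
  also have "\<dots> = (\<Prod>b\<in>Basis. (wo_vec u - wo_vec l) \<bullet> b)"
  proof (rule emeasure_lborel_box)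
    fix b :: "real^('n wo_index)"
    assume "b \<in> Basis"
    then show "wo_vec l \<bullet> b \<le> wo_vec u \<bullet> b"
      by (auto simp: Basis_vec_def inner_axis wo_vec_def le')
  qed
  also have "(\<Prod>b\<in>Basis. (wo_vec u - wo_vec l) \<bullet> b) = (\<Prod>i\<in>UNIV. u $ un_wo i - l $ un_wo i)"
    unfolding * by (simp add: wo_vec_def)
  also have "\<dots> = (\<Prod>i\<in>UNIV. u $ i - l $ i)"
    by (rule prod.reindex_bij_betw[OF bij_un_wo])
  also have "\<dots> = (\<Prod>b\<in>Basis. (u - l) \<bullet> b)"
    unfolding * by simp
  finally show "emeasure (distr lborel borel un_wo_vec) (box l u) = (\<Prod>b\<in>Basis. (u - l) \<bullet> b)" .
qed simp

lemma lborel_integral_un_wo_vec: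
  fixes f :: "real^'n \<Rightarrow> real"
  assumes [measurable]: "f \<in> borel_measurable borel"
  shows "integrable lborel (\<lambda>y. f (un_wo_vec y)) \<longleftrightarrow> integrable lborel f"
    and "(\<integral>y. f (un_wo_vec y) \<partial>lborel) = (\<integral>x. f x \<partial>lborel)"
proof -
  show "integrable lborel (\<lambda>y. f (un_wo_vec y)) \<longleftrightarrow> integrable lborel f"
    by (subst (2) lborel_un_wo_vec[symmetric], subst integrable_distr_eq) auto
  show "(\<integral>y. f (un_wo_vec y) \<partial>lborel) = (\<integral>x. f x \<partial>lborel)"
    by (subst (2) lborel_un_wo_vec[symmetric], subst integral_distr) auto
qed

text \<open>\<open>has_absolute_integral_change_of_variables\<close> concerns vector-valued
  functions and the gauge integral. Hence \<open>f\<close> is wrapped into \<open>real^1\<close> and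
  unwrapped by its only component, and continuity supplies the Borel measurability that leads back
  from \<open>lebesgue\<close> to \<open>lborel\<close>.\<close>

lemma lborel_change_of_variables_wo:
  fixes f :: "real^'k::{finite,wellorder} \<Rightarrow> real" and E :: "real^'k::_ \<Rightarrow> real^'k::_"
  assumes E: "bij E" "\<And>x. (E has_derivative (\<lambda>h. A x *v h)) (at x)"
    and A: "continuous_on UNIV A"
    and f: "continuous_on UNIV f" "integrable lborel f"
  shows "integrable lborel (\<lambda>x. \<bar>det (A x)\<bar> * f (E x))"
    and "(\<integral>x. \<bar>det (A x)\<bar> * f (E x) \<partial>lborel) = (\<integral>x. f x \<partial>lborel)"
proof -
  let ?g = "\<lambda>x. \<bar>det (A x)\<bar> * f (E x)"
  let ?F = "\<lambda>x. vec (f x) :: real^1"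
  have contE: "continuous_on UNIV E"
    using E(2) by (meson continuous_at_imp_continuous_on has_derivative_continuous)
  have contdet: "continuous_on UNIV (\<lambda>x. det (A x))"
    unfolding det_def using A by (intro continuous_intros)
  have contg: "continuous_on UNIV ?g"
    by (intro continuous_intros contdet continuous_on_compose2[OF f(1) contE]) auto
  have mg: "?g \<in> borel_measurable borel" and mf: "f \<in> borel_measurable borel"
    using contg f(1) by (auto intro: borel_measurable_continuous_onI)
  have bl: "bounded_linear (\<lambda>x. vec x :: real^1)"
    by (intro linear_conv_bounded_linear[THEN iffD1] linearI) (simp_all add: vec_eq_iff)
  have leb: "f absolutely_integrable_on UNIV"
    unfolding set_integrable_def using f(2) mf
    by (simp add: integrable_completion)
  have F: "?F absolutely_integrable_on UNIV"
    using absolutely_integrable_linear[OF leb bl] by (simp add: o_def)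
  have intF: "integral UNIV ?F = vec (integral UNIV f)"
    using integral_linear[OF set_lebesgue_integral_eq_integral(1)[OF leb] bl] by (simp add: o_def)
  have "(\<lambda>x. \<bar>det (matrix (\<lambda>h. A x *v h))\<bar> *\<^sub>R ?F (E x)) absolutely_integrable_on UNIV \<and>
      integral UNIV (\<lambda>x. \<bar>det (matrix (\<lambda>h. A x *v h))\<bar> *\<^sub>R ?F (E x)) = vec (integral UNIV f)"
    using has_absolute_integral_change_of_variables[of UNIV E "\<lambda>x h. A x *v h" ?F "vec (integral UNIV f)"]
      E F intF by (simp add: bij_def)
  then have g: "(\<lambda>x. vec (?g x) :: real^1) absolutely_integrable_on UNIV"
      "integral UNIV (\<lambda>x. vec (?g x) :: real^1) = vec (integral UNIV f)"
    by (simp_all add: vec_def scaleR_vec_def)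
  have nth: "bounded_linear (\<lambda>x::real^1. x $ 1)"
    by (rule bounded_linear_vec_nth)
  have g1: "?g absolutely_integrable_on UNIV"
    using absolutely_integrable_linear[OF g(1) nth] by (simp add: o_def)
  have g2: "integral UNIV ?g = integral UNIV f"
    using integral_linear[OF set_lebesgue_integral_eq_integral(1)[OF g(1)] nth] g(2) by (simp add: o_def)
  show ig: "integrable lborel ?g"
    using g1 mg unfolding set_integrable_def by (simp add: integrable_completion)
  show "(\<integral>x. ?g x \<partial>lborel) = (\<integral>x. f x \<partial>lborel)"
    using g2 integral_lborel[OF ig] integral_lborel[OF f(2)] by simp
qed

text \<open>\<open>E\<close> is conjugated by the relabelling to a map on well-ordered coordinates.
  Its Jacobian matrix is the reindexed \<open>A\<close>, with the same determinant by
  \<open>det_reindex\<close>, and relabelling preserves the integrals.\<close>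

lemma lborel_change_of_variables:
  fixes f :: "real^'n::finite \<Rightarrow> real" and E :: "real^'n \<Rightarrow> real^'n"
  assumes E: "bij E" "\<And>x. (E has_derivative (\<lambda>h. A x *v h)) (at x)"
    and A: "continuous_on UNIV A"
    and f: "continuous_on UNIV f" "integrable lborel f"
  shows "integrable lborel (\<lambda>x. \<bar>det (A x)\<bar> * f (E x))"
    and "(\<integral>x. \<bar>det (A x)\<bar> * f (E x) \<partial>lborel) = (\<integral>x. f x \<partial>lborel)"
proof -
  let ?g = "\<lambda>x. \<bar>det (A x)\<bar> * f (E x)"
  let ?E = "\<lambda>y. wo_vec (E (un_wo_vec y))"
  let ?A = "\<lambda>y. \<chi> i j. A (un_wo_vec y) $ un_wo i $ un_wo j"
  have det: "det (?A y) = det (A (un_wo_vec y))" for y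
    by (rule det_reindex[OF bij_un_wo])
  have contE: "continuous_on UNIV E"
    using E(2) by (meson continuous_at_imp_continuous_on has_derivative_continuous)
  have contdet: "continuous_on UNIV (\<lambda>x. det (A x))"
    unfolding det_def using A by (intro continuous_intros)
  have contg: "continuous_on UNIV ?g"
    by (intro continuous_intros contdet continuous_on_compose2[OF f(1) contE]) auto
  have mg: "?g \<in> borel_measurable borel" and mf: "f \<in> borel_measurable borel"
    using contg f(1) by (auto intro: borel_measurable_continuous_onI)
  have cu: "continuous_on UNIV (un_wo_vec :: _ \<Rightarrow> real^'n)"
    using bounded_linear_un_wo_vec linear_continuous_on by blast
  have 1: "bij ?E"
  proof (rule bijI')
    show "?E x = ?E y \<longleftrightarrow> x = y" for x y
      by (metis E(1) bij_pointE wo_vec_inverse)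
    show "\<exists>x. y = ?E x" for y
      by (metis E(1) bij_pointE wo_vec_inverse)
  qed
  have 2: "(?E has_derivative (\<lambda>h. ?A y *v h)) (at y)" for y
  proof -
    have "(?E has_derivative (\<lambda>h. wo_vec (A (un_wo_vec y) *v un_wo_vec h))) (at y)"
      by (rule bounded_linear.has_derivative[OF bounded_linear_wo_vec]
          has_derivative_compose[OF bounded_linear_imp_has_derivative[OF bounded_linear_un_wo_vec] E(2)])+
    moreover have "wo_vec (A (un_wo_vec y) *v un_wo_vec h) = ?A y *v h" for h
    proof -
      have "(\<Sum>j\<in>UNIV. A (un_wo_vec y) $ un_wo i $ j * h $ to_wo j)
          = (\<Sum>j\<in>UNIV. A (un_wo_vec y) $ un_wo i $ un_wo j * h $ to_wo (un_wo j))" for i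
        by (rule sum.reindex_bij_betw[OF bij_un_wo, symmetric])
      then show ?thesis
        by (simp add: wo_vec_def un_wo_vec_def matrix_vector_mult_def vec_eq_iff un_wo_inverse)
    qed
    ultimately show ?thesis by simp
  qed
  have 3: "continuous_on UNIV ?A"
    by (intro continuous_intros continuous_on_compose2[OF A cu]) auto
  have 4: "continuous_on UNIV (\<lambda>y. f (un_wo_vec y))"
    by (intro continuous_on_compose2[OF f(1) cu]) auto
  have 5: "integrable lborel (\<lambda>y. f (un_wo_vec y))"
    using f(2) mf lborel_integral_un_wo_vec by blast
  note * = lborel_change_of_variables_wo[OF 1 2 3 4 5]
  show "integrable lborel ?g"
    using *(1) lborel_integral_un_wo_vec(1)[OF mg] by (simp add: det)
  show "(\<integral>x. ?g x \<partial>lborel) = (\<integral>x. f x \<partial>lborel)"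
    using *(2) lborel_integral_un_wo_vec(2)[OF mg] lborel_integral_un_wo_vec(2)[OF mf] by (simp add: det)
qed

text \<open>The Leibniz sum is differentiated at the identity matrix. A permutation other than
  \<open>id\<close> moves at least two points, so a vanishing off-diagonal factor remains after any
  one factor has been differentiated. Only \<open>id\<close> contributes, and it yields the sum of
  the diagonal entries.\<close>

lemma has_derivative_det:
  "((det :: real^'n^'n \<Rightarrow> real) has_derivative trace) (at (mat 1))"
proof -
  have "((\<lambda>A :: real^'n^'n. \<Sum>p | p permutes UNIV. of_int (sign p) * (\<Prod>i\<in>UNIV. A $ i $ p i))
      has_derivative (\<lambda>B. \<Sum>p | p permutes UNIV. of_int (sign p) *
         (\<Sum>i\<in>UNIV. B $ i $ p i * (\<Prod>j\<in>UNIV - {i}. (mat 1 :: real^'n^'n) $ j $ p j)))) (at (mat 1))"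
    by (auto intro!: derivative_eq_intros bounded_linear_imp_has_derivative
        bounded_linear_compose[OF bounded_linear_vec_nth bounded_linear_vec_nth] simp: sum_distrib_left)
  moreover have "(\<Sum>p | p permutes UNIV. of_int (sign p) *
         (\<Sum>i\<in>UNIV. B $ i $ p i * (\<Prod>j\<in>UNIV - {i}. (mat 1 :: real^'n^'n) $ j $ p j))) = trace B" 
    for B :: "real^'n^'n"
  proof -
    have 0: "(\<Prod>j\<in>UNIV - {i}. (mat 1 :: real^'n^'n) $ j $ p j) = 0" if p: "p permutes UNIV" "p \<noteq> id" for p i
    proof -
      obtain k where k: "p k \<noteq> k"
        using p(2) by fastforce
      obtain j where "j \<noteq> i" "p j \<noteq> j"
        by (metis k p(1) permutes_inj injD)
      then show ?thesis
        by (intro prod_zero bexI[of _ j]) (auto simp: mat_def)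
    qed
    have "(\<Sum>p | p permutes UNIV. of_int (sign p) *
         (\<Sum>i\<in>UNIV. B $ i $ p i * (\<Prod>j\<in>UNIV - {i}. (mat 1 :: real^'n^'n) $ j $ p j)))
      = (\<Sum>p\<in>{id}. of_int (sign p) *
         (\<Sum>i\<in>UNIV. B $ i $ p i * (\<Prod>j\<in>UNIV - {i}. (mat 1 :: real^'n^'n) $ j $ p j)))"
      by (rule sum.mono_neutral_right) (auto simp: finite_permutations permutes_id 0)
    then show ?thesis
      by (simp add: trace_def mat_def)
  qed
  ultimately show ?thesis
    by (simp add: det_def[abs_def])
qed

section \<open>Functions of class \<open>C\<^sup>k([0,T]; C\<^sup>l\<^sub>l\<^sub>o\<^sub>c)\<close>\<close>

lemma has_derivative_grad:
  assumes "f differentiable (at x)"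
  shows "(f has_derivative (\<lambda>h. grad f x \<bullet> h)) (at x)"
proof -
  let ?D = "frechet_derivative f (at x)"
  have D: "(f has_derivative ?D) (at x)"
    using assms frechet_derivative_works by blast
  then interpret linear ?D
    by (rule has_derivative_linear)
  have "?D h = grad f x \<bullet> h" for h
  proof -
    have "?D h = ?D (\<Sum>i\<in>UNIV. h $ i *\<^sub>R axis i 1)"
      by (simp add: basis_expansion flip: scalar_mult_eq_scaleR)
    also have "\<dots> = grad f x \<bullet> h"
      by (simp add: sum scale inner_vec_def grad_def partial_def mult.commute)
    finally show ?thesis .
  qed
  then have "?D = (\<lambda>h. grad f x \<bullet> h)" by auto
  with D show ?thesis by simp
qed

lemma partial_eqI:
  assumes "(f has_derivative f') (at x)"
  shows "partial i f x = f' (axis i 1)"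
  unfolding partial_def using frechet_derivative_at[OF assms] by simp

lemma grad_eqI:
  assumes "(f has_derivative (\<lambda>h. G \<bullet> h)) (at x)"
  shows "grad f x = G"
  by (simp add: vec_eq_iff grad_def partial_eqI[OF assms] inner_axis)

lemma partials_append: "partials (is @ js) f = partials is (partials js f)"
  by (induction "is") auto

lemma C_space_mono: "l \<le> l' \<Longrightarrow> C_space l' \<subseteq> C_space l"
  unfolding C_space_def by auto

lemma C_space_partial:
  assumes "f \<in> C_space (Suc l)"
  shows "partial i f \<in> C_space l"
proof -
  \<comment> \<open>The head of the list is the outermost derivative, so differentiating first in
    direction \<open>i\<close> appends \<open>i\<close> at the end.\<close>
  have *: "partials is (partial i f) = partials (is @ [i]) f" for "is"
    by (simp add: partials_append)
  show ?thesis
    using assms unfolding C_space_def mem_Collect_eq * by force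
qed

lemma C_space_differentiable: "f \<in> C_space (Suc l) \<Longrightarrow> f differentiable (at x)"
  unfolding C_space_def by (auto dest!: conjunct2 dest: spec[of _ "[]"])

lemma C_space_continuous: "f \<in> C_space l \<Longrightarrow> continuous_on UNIV f"
  unfolding C_space_def by (auto dest!: conjunct1 dest: spec[of _ "[]"])

lemma partials_cmult:
  assumes "f \<in> C_space l" "length is \<le> l"
  shows "partials is (\<lambda>x. c * f x) = (\<lambda>x. c * partials is f x)"
  using assms(2)
proof (induction "is")
  case (Cons i "is")
  have "partials is f differentiable (at x)" for x
    using assms(1) Cons.prems unfolding C_space_def by auto
  from has_derivative_mult_right[OF has_derivative_grad[OF this]]
  have "partial i (\<lambda>x. c * partials is f x) x = c * partial i (partials is f) x" for x
    using partial_eqI has_derivative_grad[OF \<open>\<And>x. partials is f differentiable (at x)\<close>] by metis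
  with Cons show ?case
    by auto
qed simp

lemma C_space_cmult:
  assumes "f \<in> C_space l"
  shows "(\<lambda>x. c * f x) \<in> C_space l"
  using assms unfolding C_space_def
  by (auto simp: partials_cmult[OF assms] intro!: continuous_intros derivative_intros)

lemma CC_loc_0_cmult:
  assumes "f \<in> CC_loc 0 l T"
  shows "(\<lambda>x t. c * f x t) \<in> CC_loc 0 l T"
proof -
  have f: "(\<lambda>x. f x t) \<in> C_space l" if "t \<in> {0..T}" for t
    using assms that by auto
  have "C_converges l K (\<lambda>s x. c * f x s) (\<lambda>x. c * f x t) (at t within {0..T})"
    if K: "compact K" and t: "t \<in> {0..T}" for K t
    unfolding C_converges_def
  proof (intro allI impI)
    fix "is" :: "'a list"
    assume l: "length is \<le> l"
    have "C_converges l K (\<lambda>s x. f x s) (\<lambda>x. f x t) (at t within {0..T})"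
      using assms K t by auto
    then have "uniform_limit K (\<lambda>s x. c * partials is (\<lambda>x. f x s) x) (\<lambda>x. c * partials is (\<lambda>x. f x t) x)
        (at t within {0..T})"
      using l unfolding C_converges_def by (intro bounded_linear_uniform_limit_intros) auto
    \<comment> \<open>\<open>partials_cmult\<close> needs a slice in \<open>C_space l\<close>, which
      is available only for \<open>s\<close> in \<open>{0..T}\<close>; the two families therefore
      agree eventually along the filter, not for every \<open>s\<close>.\<close>
    moreover have "\<forall>\<^sub>F s in at t within {0..T}. \<forall>x\<in>K. c * partials is (\<lambda>x. f x s) x = partials is (\<lambda>x. c * f x s) x"
      using partials_cmult[OF f l] by (auto simp: eventually_at_filter)
    ultimately show "uniform_limit K (\<lambda>s. partials is (\<lambda>x. c * f x s)) (partials is (\<lambda>x. c * f x t))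
        (at t within {0..T})"
      unfolding partials_cmult[OF f[OF t] l] by (subst uniform_limit_cong[symmetric, rotated 2]) auto
  qed
  then show ?thesis
    using f by (auto intro: C_space_cmult)
qed

lemma C_converges_0: "C_converges 0 K u w F \<longleftrightarrow> uniform_limit K u w F"
  unfolding C_converges_def by auto

lemma CC_loc_1I:
  assumes "\<And>t. t \<in> {0..T} \<Longrightarrow> (\<lambda>x. f x t) \<in> C_space l" "g \<in> CC_loc 0 l T"
    "\<And>K t. compact K \<Longrightarrow> t \<in> {0..T} \<Longrightarrow>
        C_converges l K (\<lambda>s x. (f x s - f x t) / (s - t)) (\<lambda>x. g x t) (at t within {0..T})"
  shows "f \<in> CC_loc 1 l T"
  unfolding One_nat_def CC_loc.simps(2) using assms by blast

lemma CC_loc_1_cmult: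
  assumes "f \<in> CC_loc 1 0 T"
  shows "(\<lambda>x t. c * f x t) \<in> CC_loc 1 0 T"
proof -
  obtain g where g: "g \<in> CC_loc 0 0 T"
    "\<And>K t. compact K \<Longrightarrow> t \<in> {0..T} \<Longrightarrow>
        uniform_limit K (\<lambda>s x. (f x s - f x t) / (s - t)) (\<lambda>x. g x t) (at t within {0..T})"
    using assms by (auto simp: C_converges_0 simp del: CC_loc.simps(1))
  have "C_converges 0 K (\<lambda>s x. (c * f x s - c * f x t) / (s - t)) (\<lambda>x. c * g x t) (at t within {0..T})"
    if "compact K" "t \<in> {0..T}" for K t
  proof -
    have "uniform_limit K (\<lambda>s x. c * ((f x s - f x t) / (s - t))) (\<lambda>x. c * g x t) (at t within {0..T})"
      by (intro bounded_linear_uniform_limit_intros g that)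
    then show ?thesis
      unfolding C_converges_0 by (simp add: algebra_simps)
  qed
  moreover have "(\<lambda>x. c * f x t) \<in> C_space 0" if "t \<in> {0..T}" for t
    using assms that by (auto intro: C_space_cmult)
  ultimately show ?thesis
    using CC_loc_0_cmult[OF g(1)] by (intro CC_loc_1I)
qed

lemma CC_loc_mono:
  assumes "f \<in> CC_loc 0 l' T" "l \<le> l'"
  shows "f \<in> CC_loc 0 l T"
  using assms C_space_mono[OF assms(2)] unfolding CC_loc.simps C_converges_def by fastforce

lemma CC_loc_0_partial:
  assumes "f \<in> CC_loc 0 (Suc l) T"
  shows "(\<lambda>x t. partial i (\<lambda>y. f y t) x) \<in> CC_loc 0 l T"
proof -
  have *: "partials is (\<lambda>x. partial i h x) = partials (is @ [i]) h" for "is" h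
    by (simp add: partials_append)
  have "(\<lambda>x. partial i (\<lambda>y. f y t) x) \<in> C_space l" if "t \<in> {0..T}" for t
    using assms that by (auto intro!: C_space_partial)
  moreover have "C_converges l K (\<lambda>s x. partial i (\<lambda>y. f y s) x) (\<lambda>x. partial i (\<lambda>y. f y t) x) (at t within {0..T})"
    if "t \<in> {0..T}" "compact K" for t K
  proof -
    have "C_converges (Suc l) K (\<lambda>s x. f x s) (\<lambda>x. f x t) (at t within {0..T})"
      using assms that by simp
    then show ?thesis
      unfolding C_converges_def * by (auto dest: spec[of _ "_ @ [i]"])
  qed
  ultimately show ?thesis by simp
qed

text \<open>The difference quotients in time converge in \<open>C^1(K)\<close>, and
  \<open>partial i\<close> of such a quotient is the quotient of the partial derivatives. So space
  and time derivatives commute, and the time derivative is \<open>partial i\<close> of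
  \<open>g\<close>. Applied to \<open>\<theta>\<close>, this makes the velocity differentiable in
  time.\<close>

lemma CC_loc_1_partial:
  assumes "f \<in> CC_loc 1 1 T"
  shows "(\<lambda>x t. partial i (\<lambda>y. f y t) x) \<in> CC_loc 1 0 T"
proof -
  obtain g where f: "\<And>t. t \<in> {0..T} \<Longrightarrow> (\<lambda>x. f x t) \<in> C_space 1" and g: "g \<in> CC_loc 0 1 T"
    "\<And>K t. compact K \<Longrightarrow> t \<in> {0..T} \<Longrightarrow>
        C_converges 1 K (\<lambda>s x. (f x s - f x t) / (s - t)) (\<lambda>x. g x t) (at t within {0..T})"
    using assms by (auto simp del: CC_loc.simps(1))
  have eq: "partial i (\<lambda>x. (f x s - f x t) / (s - t)) = (\<lambda>x. (partial i (\<lambda>x. f x s) x - partial i (\<lambda>x. f x t) x) / (s - t))"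
    if "s \<in> {0..T}" "t \<in> {0..T}" for s t
  proof
    fix x
    have d: "((\<lambda>x. f x r) has_derivative (\<lambda>h. grad (\<lambda>x. f x r) x \<bullet> h)) (at x)" if "r \<in> {0..T}" for r
      using f[OF that] by (auto intro!: has_derivative_grad C_space_differentiable)
    have "((\<lambda>x. (f x s - f x t) / (s - t)) has_derivative
        (\<lambda>h. (grad (\<lambda>x. f x s) x \<bullet> h - grad (\<lambda>x. f x t) x \<bullet> h) / (s - t))) (at x)"
      unfolding divide_inverse by (intro derivative_intros d that)
    from partial_eqI[OF this] show "partial i (\<lambda>x. (f x s - f x t) / (s - t)) x
        = (partial i (\<lambda>x. f x s) x - partial i (\<lambda>x. f x t) x) / (s - t)"
      by (simp add: inner_axis grad_def)
  qed
  have "C_converges 0 K (\<lambda>s x. (partial i (\<lambda>y. f y s) x - partial i (\<lambda>y. f y t) x) / (s - t))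
      (\<lambda>x. partial i (\<lambda>y. g y t) x) (at t within {0..T})"
    if t: "t \<in> {0..T}" and K: "compact K" for t K
  proof -
    have "uniform_limit K (\<lambda>s. partial i (\<lambda>x. (f x s - f x t) / (s - t))) (partial i (\<lambda>x. g x t)) (at t within {0..T})"
      using g(2)[OF K t] unfolding C_converges_def by (auto dest: spec[of _ "[i]"])
    moreover have "\<forall>\<^sub>F s in at t within {0..T}. \<forall>x\<in>K. partial i (\<lambda>x. (f x s - f x t) / (s - t)) x
        = (partial i (\<lambda>y. f y s) x - partial i (\<lambda>y. f y t) x) / (s - t)"
      using t by (auto simp: eventually_at_filter eq)
    ultimately show ?thesis
      unfolding C_converges_0 by (subst uniform_limit_cong[symmetric, rotated 2]) auto
  qed
  moreover have "(\<lambda>x t. partial i (\<lambda>y. g y t) x) \<in> CC_loc 0 0 T"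
    using g(1) by (intro CC_loc_0_partial) simp
  moreover have "(\<lambda>x. partial i (\<lambda>y. f y t) x) \<in> C_space 0" if "t \<in> {0..T}" for t
    using f[OF that] by (intro C_space_partial) simp
  ultimately show ?thesis
    by (intro CC_loc_1I)
qed

text \<open>Convergence in time is uniform on the compact neighbourhood \<open>cball x 1\<close>, so
  it can be added to the continuity in space of the single slice at time \<open>t\<close>.\<close>

lemma CC_loc_0_continuous:
  assumes "f \<in> CC_loc 0 l T"
  shows "continuous_on (UNIV \<times> {0..T}) (\<lambda>z. f (fst z) (snd z))"
  unfolding continuous_on_iff
proof (clarify, unfold fst_conv snd_conv)
  fix x :: "real^'a" and t e :: real
  assume t: "t \<in> {0..T}" and e: "0 < e"
  have c: "continuous_on UNIV (\<lambda>x. f x t)"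
    using assms t by (auto intro: C_space_continuous)
  then obtain d1 where d1: "d1 > 0" "\<And>y. dist y x < d1 \<Longrightarrow> dist (f y t) (f x t) < e / 2"
    unfolding continuous_on_iff using e by (metis UNIV_I half_gt_zero)
  have "uniform_limit (cball x 1) (\<lambda>s x. f x s) (\<lambda>x. f x t) (at t within {0..T})"
  proof -
    have "C_converges l (cball x 1) (\<lambda>s x. f x s) (\<lambda>x. f x t) (at t within {0..T})"
      using assms t by auto
    then show ?thesis
      unfolding C_converges_def by (auto dest: spec[of _ "[]"])
  qed
  from uniform_limitD[OF this, of "e / 2"] e
  obtain d2 where d2: "d2 > 0"
    "\<And>s y. s \<in> {0..T} \<Longrightarrow> s \<noteq> t \<Longrightarrow> dist s t < d2 \<Longrightarrow> y \<in> cball x 1 \<Longrightarrow> dist (f y s) (f y t) < e / 2"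
    unfolding eventually_at by auto
  \<comment> \<open>The filter \<open>at t within {0..T}\<close> leaves out \<open>s = t\<close>,
    where the distance is \<open>0\<close>.\<close>
  have d2': "dist (f y s) (f y t) < e / 2" if "s \<in> {0..T}" "dist s t < d2" "y \<in> cball x 1" for s y
    using d2(2)[of s y] that e by (cases "s = t") auto
  show "\<exists>d>0. \<forall>z\<in>UNIV \<times> {0..T}. dist z (x, t) < d \<longrightarrow> dist (f (fst z) (snd z)) (f x t) < e"
  proof (intro exI[of _ "min 1 (min d1 d2)"] conjI ballI impI)
    fix z :: "(real^'a) \<times> real"
    assume z: "z \<in> UNIV \<times> {0..T}" "dist z (x, t) < min 1 (min d1 d2)"
    obtain y s where zz: "z = (y, s)" by force
    have "dist y x \<le> dist z (x, t)" "dist s t \<le> dist z (x, t)"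
      using dist_fst_le[of z "(x, t)"] dist_snd_le[of z "(x, t)"] zz by auto
    then have "dist (f y t) (f x t) < e / 2" "dist (f y s) (f y t) < e / 2"
      using z zz by (auto intro!: d1(2) d2'[of s y] simp only: mem_cball dist_commute[of x y] prod.sel mem_Times_iff)
    then show "dist (f (fst z) (snd z)) (f x t) < e"
      unfolding zz dist_real_def fst_conv snd_conv by linarith
  qed (use d1 d2 in auto)
qed

section \<open>Joint differentiability in space and time\<close>

lemma CC_loc_1_time_derivative:
  assumes "f \<in> CC_loc 1 l T"
  obtains g where "g \<in> CC_loc 0 l T"
    "\<And>x t. t \<in> {0..T} \<Longrightarrow> ((\<lambda>s. f x s) has_real_derivative g x t) (at t within {0..T})"
proof -
  obtain g where g: "g \<in> CC_loc 0 l T"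
    "\<And>K t. compact K \<Longrightarrow> t \<in> {0..T} \<Longrightarrow>
        C_converges l K (\<lambda>s x. (f x s - f x t) / (s - t)) (\<lambda>x. g x t) (at t within {0..T})"
    using assms by (auto simp del: CC_loc.simps(1))
  show ?thesis
  proof (rule that[OF g(1)])
    fix x :: "real^'a" and t
    assume t: "t \<in> {0..T}"
    have "uniform_limit {x} (\<lambda>s x. (f x s - f x t) / (s - t)) (\<lambda>x. g x t) (at t within {0..T})"
      using g(2)[OF _ t, of "{x}"] unfolding C_converges_def by (auto dest: spec[of _ "[]"])
    then show "((\<lambda>s. f x s) has_real_derivative g x t) (at t within {0..T})"
      unfolding has_field_derivative_iff by (rule tendsto_uniform_limitI) simp
  qed
qed

text \<open>Differentiability in space together with a jointly continuous time derivative gives a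
  total derivative on the closed slab, one-sided at the end times.
  \<open>has_derivative_partialsI\<close> asks for joint continuity of one of the two partial
  derivatives; here it is the one in time.\<close>

lemma CC_loc_joint_derivative:
  assumes f: "f \<in> CC_loc 1 0 T" "f \<in> CC_loc 0 1 T"
  obtains g where
    "continuous_on (UNIV \<times> {0..T}) (\<lambda>z. g (fst z) (snd z))"
    "\<And>x t. t \<in> {0..T} \<Longrightarrow> ((\<lambda>s. f x s) has_real_derivative g x t) (at t within {0..T})"
    "continuous_on (UNIV \<times> {0..T}) (\<lambda>z. grad (\<lambda>y. f y (snd z)) (fst z))"
    "\<And>z. z \<in> UNIV \<times> {0..T} \<Longrightarrow> ((\<lambda>z. f (fst z) (snd z)) has_derivative
        (\<lambda>h. (grad (\<lambda>y. f y (snd z)) (fst z), g (fst z) (snd z)) \<bullet> h)) (at z within UNIV \<times> {0..T})"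
proof -
  obtain g where g: "g \<in> CC_loc 0 0 T"
    "\<And>x t. t \<in> {0..T} \<Longrightarrow> ((\<lambda>s. f x s) has_real_derivative g x t) (at t within {0..T})"
    using CC_loc_1_time_derivative[OF f(1)] by blast
  have gc: "continuous_on (UNIV \<times> {0..T}) (\<lambda>z. g (fst z) (snd z))"
    by (rule CC_loc_0_continuous[OF g(1)])
  show ?thesis
  proof (rule that[OF gc g(2)])
    show "continuous_on (UNIV \<times> {0..T}) (\<lambda>z. grad (\<lambda>y. f y (snd z)) (fst z))"
      unfolding grad_def using f(2)
      by (intro continuous_on_vec_lambda CC_loc_0_continuous[where l = 0] CC_loc_0_partial) simp
    fix z :: "(real^'a) \<times> real"
    assume "z \<in> UNIV \<times> {0..T}"
    then obtain x t where z: "z = (x, t)" and t: "t \<in> {0..T}" by auto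
    have "((\<lambda>(x, t). f x t) has_derivative
        (\<lambda>(tx, ty). grad (\<lambda>y. f y t) x \<bullet> tx + blinfun_scaleR_left (g x t) ty)) (at (x, t) within UNIV \<times> {0..T})"
    proof (rule has_derivative_partialsI[where fy = "\<lambda>x t. blinfun_scaleR_left (g x t)"])
      show "((\<lambda>x. f x t) has_derivative (\<lambda>tx. grad (\<lambda>y. f y t) x \<bullet> tx)) (at x)"
        using f(2) t by (auto intro!: has_derivative_grad C_space_differentiable)
      show "((\<lambda>t. f x t) has_derivative blinfun_apply (blinfun_scaleR_left (g x t))) (at t within {0..T})"
        if "t \<in> {0..T}" for x t
        using g(2)[OF that, of x] by (simp add: has_field_derivative_def mult_commute_abs)
      have "continuous (at (x, t) within UNIV \<times> {0..T}) (\<lambda>z. g (fst z) (snd z))"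
        using gc t by (auto simp: continuous_on_eq_continuous_within)
      then show "continuous (at (x, t) within UNIV \<times> {0..T}) (\<lambda>(x, t). blinfun_scaleR_left (g x t))"
        unfolding case_prod_unfold
        by (rule bounded_linear.continuous[OF bounded_linear_blinfun_scaleR_left])
    qed (use t in auto)
    then show "((\<lambda>z. f (fst z) (snd z)) has_derivative
        (\<lambda>h. (grad (\<lambda>y. f y (snd z)) (fst z), g (fst z) (snd z)) \<bullet> h)) (at z within UNIV \<times> {0..T})"
      unfolding z by (simp add: case_prod_unfold inner_prod_def mult.commute)
  qed
qed

text \<open>The point is that \<open>\<delta>\<close> does not depend on the base point in the ball
  of radius \<open>R\<close>. \<open>D\<close> is uniformly continuous on a slightly larger compact
  set, and the mean value inequality on a small convex product turns its oscillation into the error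
  bound.\<close>

lemma C1_uniform_linearization:
  fixes f :: "'a::euclidean_space \<times> real \<Rightarrow> real"
  assumes D: "\<And>z. z \<in> UNIV \<times> {0..T} \<Longrightarrow> (f has_derivative (\<lambda>h. D z \<bullet> h)) (at z within UNIV \<times> {0..T})"
    and cont: "continuous_on (UNIV \<times> {0..T}) D"
    and e: "e > 0"
  obtains \<delta> where "\<delta> > 0"
    "\<And>x t y s. norm x \<le> R \<Longrightarrow> t \<in> {0..T} \<Longrightarrow> s \<in> {0..T} \<Longrightarrow> norm (y - x) \<le> \<delta> \<Longrightarrow> \<bar>s - t\<bar> \<le> \<delta> \<Longrightarrow>
       \<bar>f (y, s) - f (x, t) - D (x, t) \<bullet> (y - x, s - t)\<bar> \<le> e * norm (y - x, s - t)"
proof -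
  let ?K = "cball 0 (R + 1) \<times> {0..T} :: ('a \<times> real) set"
  have "uniformly_continuous_on ?K D"
    by (intro compact_uniformly_continuous continuous_on_subset[OF cont] compact_Times) auto
  then obtain d where d: "d > 0" "\<And>z z'. z \<in> ?K \<Longrightarrow> z' \<in> ?K \<Longrightarrow> dist z' z < d \<Longrightarrow> dist (D z') (D z) < e"
    using e unfolding uniformly_continuous_on_def by metis
  \<comment> \<open>The bound \<open>1\<close> keeps neighbouring points inside the ball of radius
    \<open>R + 1\<close>; \<open>d / 3\<close> leaves room to add a space and a time distance of at
    most \<open>\<delta>\<close> each and stay below \<open>d\<close>.\<close>
  define \<delta> where "\<delta> = min 1 (d / 3)"
  have \<delta>: "\<delta> > 0" "\<delta> \<le> 1" "2 * \<delta> < d"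
    using d(1) by (auto simp: \<delta>_def)
  show ?thesis
  proof (rule that[OF \<delta>(1)])
    fix x y :: 'a and t s :: real
    assume x: "norm x \<le> R" and t: "t \<in> {0..T}" and s: "s \<in> {0..T}"
      and ys: "norm (y - x) \<le> \<delta>" "\<bar>s - t\<bar> \<le> \<delta>"
    let ?S = "cball x \<delta> \<times> ({0..T} \<inter> cball t \<delta>)"
    have conv: "convex ?S"
      by (intro convex_Times convex_Int) auto
    have xt: "(x, t) \<in> ?S" and yst: "(y, s) \<in> ?S"
      using \<delta> t s ys by (auto simp: dist_norm norm_minus_commute dist_real_def)
    have "norm (f (y, s) - f (x, t) - D (x, t) \<bullet> ((y, s) - (x, t))) \<le> norm ((y, s) - (x, t)) * e"
    proof (rule differentiable_bound_linearization[where S = ?S and f' = "\<lambda>z h. D z \<bullet> h"])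
      show "(x, t) + r *\<^sub>R ((y, s) - (x, t)) \<in> ?S" if "r \<in> {0..1}" for r
        using convexD_alt[OF conv xt yst, of r] that by (simp add: algebra_simps)
      show "(f has_derivative (\<lambda>h. D z \<bullet> h)) (at z within ?S)" if "z \<in> ?S" for z
        using that by (intro has_derivative_subset[OF D]) auto
      show "onorm ((\<lambda>h. D z \<bullet> h) - (\<lambda>h. D (x, t) \<bullet> h)) \<le> e" if z: "z \<in> ?S" for z
      proof (rule onorm_le)
        obtain y' s' where z': "z = (y', s')" by force
        have "norm y' \<le> norm x + dist x y'"
          by (metis dist_norm norm_minus_commute norm_triangle_sub)
        then have zK: "z \<in> ?K" "(x, t) \<in> ?K"
          using z x t \<delta> by (auto simp: z')
        have "dist z (x, t) \<le> dist y' x + dist s' t"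
          unfolding z' dist_prod_def using sqrt_sum_squares_le_sum by (auto simp: dist_Pair_Pair)
        also have "\<dots> < d"
          using z \<delta> by (auto simp: z' dist_commute)
        finally have "dist (D z) (D (x, t)) < e"
          using d(2) zK by blast
        then have "norm (D z - D (x, t)) \<le> e"
          by (simp add: dist_norm)
        then show "norm (((\<lambda>h. D z \<bullet> h) - (\<lambda>h. D (x, t) \<bullet> h)) h) \<le> e * norm h" for h
          by (simp flip: inner_diff_left)
            (meson Cauchy_Schwarz_ineq2 mult_right_mono norm_ge_zero order_trans)
      qed
    qed (rule xt)
    then show "\<bar>f (y, s) - f (x, t) - D (x, t) \<bullet> (y - x, s - t)\<bar> \<le> e * norm (y - x, s - t)"
      by (simp add: mult.commute)
  qed
qed

section \<open>The velocity field of a Madelung solution\<close>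

text \<open>\<open>A\<close> is the spatial Jacobian and \<open>w\<close> the time derivative of the
  velocity. Each component is a multiple of \<open>partial i\<close> of \<open>\<theta>\<close>: two
  space derivatives of \<open>\<theta>\<close> give the regularity in space, and membership in
  \<open>CC_loc 1 1 T\<close> the one in time.\<close>

lemma velocity_joint_derivative:
  fixes \<theta> :: "real^'n \<Rightarrow> real \<Rightarrow> real"
  assumes \<theta>: "\<theta> \<in> CC_loc 0 2 T" "\<theta> \<in> CC_loc 1 1 T" and v: "v = velocity m \<theta>"
  obtains A w where
    "continuous_on (UNIV \<times> {0..T}) (\<lambda>z. A (fst z) (snd z) :: real^'n^'n)"
    "continuous_on (UNIV \<times> {0..T}) (\<lambda>z. w (fst z) (snd z))"
    "\<And>x t. t \<in> {0..T} \<Longrightarrow> ((\<lambda>x. v x t) has_derivative (\<lambda>h. A x t *v h)) (at x)"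
    "\<And>z. z \<in> UNIV \<times> {0..T} \<Longrightarrow> ((\<lambda>z. v (fst z) (snd z)) has_derivative
        (\<lambda>h. A (fst z) (snd z) *v fst h + snd h *\<^sub>R w (fst z) (snd z))) (at z within UNIV \<times> {0..T})"
proof -
  have v1: "(\<lambda>x t. v x t $ i) \<in> CC_loc 1 0 T" for i
    using CC_loc_1_cmult[OF CC_loc_1_partial[OF \<theta>(2), of i], of "1 / m"]
    by (simp add: v velocity_def grad_def)
  have v0: "(\<lambda>x t. v x t $ i) \<in> CC_loc 0 1 T" for i
    using CC_loc_0_cmult[OF CC_loc_0_partial[of \<theta> 1 T i], of "1 / m"] \<theta>(1)
    by (simp add: v velocity_def grad_def numeral_2_eq_2)
  let ?P = "\<lambda>i g. continuous_on (UNIV \<times> {0..T}) (\<lambda>z. g (fst z) (snd z)) \<and>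
    continuous_on (UNIV \<times> {0..T}) (\<lambda>z. grad (\<lambda>y. v y (snd z) $ i) (fst z)) \<and>
    (\<forall>z\<in>UNIV \<times> {0..T}. ((\<lambda>z. v (fst z) (snd z) $ i) has_derivative
        (\<lambda>h. (grad (\<lambda>y. v y (snd z) $ i) (fst z), g (fst z) (snd z)) \<bullet> h)) (at z within UNIV \<times> {0..T}))"
  have "\<exists>g. ?P i g" for i
  proof (rule CC_loc_joint_derivative[OF v1[of i] v0[of i]])
    fix g
    assume *: "continuous_on (UNIV \<times> {0..T}) (\<lambda>z. g (fst z) (snd z))"
      "continuous_on (UNIV \<times> {0..T}) (\<lambda>z. grad (\<lambda>y. v y (snd z) $ i) (fst z))"
      "\<And>z. z \<in> UNIV \<times> {0..T} \<Longrightarrow> ((\<lambda>z. v (fst z) (snd z) $ i) has_derivative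
        (\<lambda>h. (grad (\<lambda>y. v y (snd z) $ i) (fst z), g (fst z) (snd z)) \<bullet> h)) (at z within UNIV \<times> {0..T})"
    show "\<exists>g. ?P i g"
      by (intro exI[of _ g] conjI ballI *)
  qed
  then obtain g where "\<forall>i. ?P i (g i)"
    using choice[of ?P] by presburger
  then have g: "\<And>i. continuous_on (UNIV \<times> {0..T}) (\<lambda>z. g i (fst z) (snd z))"
    "\<And>i. continuous_on (UNIV \<times> {0..T}) (\<lambda>z. grad (\<lambda>y. v y (snd z) $ i) (fst z))"
    "\<And>i z. z \<in> UNIV \<times> {0..T} \<Longrightarrow> ((\<lambda>z. v (fst z) (snd z) $ i) has_derivative
        (\<lambda>h. (grad (\<lambda>y. v y (snd z) $ i) (fst z), g i (fst z) (snd z)) \<bullet> h)) (at z within UNIV \<times> {0..T})"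
    by blast+
  define A where "A x t = (\<chi> i. grad (\<lambda>y. v y t $ i) x)" for x t
  define w where "w x t = (\<chi> i. g i x t)" for x t
  show ?thesis
  proof (rule that[of A w])
    show "continuous_on (UNIV \<times> {0..T}) (\<lambda>z. A (fst z) (snd z))"
      "continuous_on (UNIV \<times> {0..T}) (\<lambda>z. w (fst z) (snd z))"
      unfolding A_def w_def by (intro continuous_on_vec_lambda g)+
    show "((\<lambda>x. v x t) has_derivative (\<lambda>h. A x t *v h)) (at x)" if "t \<in> {0..T}" for x t
    proof -
      have "((\<lambda>x. v x t $ i) has_derivative (\<lambda>h. (A x t *v h) $ i)) (at x)" for i
        using has_derivative_grad[OF C_space_differentiable[of "\<lambda>x. v x t $ i" 0 x]] v0[of i] that
        by (simp add: A_def matrix_vector_mul_component)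
      then show ?thesis
        unfolding has_derivative_componentwise_within[of "\<lambda>x. v x t"]
        by (auto simp: Basis_vec_def inner_axis)
    qed
    show "((\<lambda>z. v (fst z) (snd z)) has_derivative
        (\<lambda>h. A (fst z) (snd z) *v fst h + snd h *\<^sub>R w (fst z) (snd z))) (at z within UNIV \<times> {0..T})"
      if "z \<in> UNIV \<times> {0..T}" for z
    proof -
      have "((\<lambda>z. v (fst z) (snd z) $ i) has_derivative
        (\<lambda>h. (A (fst z) (snd z) *v fst h + snd h *\<^sub>R w (fst z) (snd z)) $ i)) (at z within UNIV \<times> {0..T})" for i
        using g(3)[OF that, of i]
        by (simp add: A_def w_def matrix_vector_mul_component inner_prod_def mult.commute)
      then show ?thesis
        unfolding has_derivative_componentwise_within[of "\<lambda>z. v (fst z) (snd z)"]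
        by (auto simp: Basis_vec_def inner_axis)
    qed
  qed
qed

text \<open>The chain rule is used twice: along a characteristic it produces the material
  acceleration, and along a constant curve it recovers \<open>w\<close> as the partial time
  derivative.\<close>

lemma vector_derivative_along_curve:
  fixes v w :: "real^'n \<Rightarrow> real \<Rightarrow> real^'n"
  assumes D: "\<And>z. z \<in> UNIV \<times> {0..T} \<Longrightarrow> ((\<lambda>z. v (fst z) (snd z)) has_derivative
        (\<lambda>h. A (fst z) (snd z) *v fst h + snd h *\<^sub>R w (fst z) (snd z))) (at z within UNIV \<times> {0..T})"
    and t: "t \<in> {0<..<T}" and c: "(c has_vector_derivative c') (at t)"
  shows "((\<lambda>s. v (c s) s) has_vector_derivative A (c t) t *v c' + w (c t) t) (at t)"
proof -
  \<comment> \<open>Over the open interval the graph of \<open>c\<close> stays in the slab, and at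
    an interior time the derivative within that interval is the two-sided one.\<close>
  have "((\<lambda>s. (c s, s)) has_derivative (\<lambda>h. (h *\<^sub>R c', h))) (at t within {0<..<T})"
    using c has_derivative_at_withinI unfolding has_vector_derivative_def
    by (intro has_derivative_Pair has_derivative_ident) blast
  then have "((\<lambda>s. (\<lambda>z. v (fst z) (snd z)) (c s, s)) has_derivative
     (\<lambda>h. A (fst (c t, t)) (snd (c t, t)) *v fst (h *\<^sub>R c', h) + snd (h *\<^sub>R c', h) *\<^sub>R w (fst (c t, t)) (snd (c t, t)))) (at t within {0<..<T})"
    by (rule has_derivative_in_compose2[where t = "UNIV \<times> {0..T}", rotated 3]) (use D t in auto)
  then show ?thesis
    using t unfolding has_vector_derivative_def
    by (simp add: at_within_open[of t "{0<..<T}"] scaleR_add_right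
        matrix_scaleR_vector_ac flip: scaleR_matrix_vector_assoc)
qed

lemma material_acceleration_eq:
  fixes v w :: "real^'n \<Rightarrow> real \<Rightarrow> real^'n"
  assumes A: "\<And>x t. t \<in> {0..T} \<Longrightarrow> ((\<lambda>x. v x t) has_derivative (\<lambda>h. A x t *v h)) (at x)"
    and D: "\<And>z. z \<in> UNIV \<times> {0..T} \<Longrightarrow> ((\<lambda>z. v (fst z) (snd z)) has_derivative
        (\<lambda>h. A (fst z) (snd z) *v fst h + snd h *\<^sub>R w (fst z) (snd z))) (at z within UNIV \<times> {0..T})"
    and t: "t \<in> {0<..<T}"
  shows "material_acceleration v x t = A x t *v v x t + w x t"
proof -
  have "((\<lambda>s. v x s) has_vector_derivative A x t *v 0 + w x t) (at t)"
    by (rule vector_derivative_along_curve[OF D t]) auto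
  then have "vector_derivative (\<lambda>s. v x s) (at t) = w x t"
    by (simp add: vector_derivative_at)
  moreover have "jacobian (\<lambda>y. v y t) (at x) = A x t"
    using frechet_derivative_at[OF A[of t x], symmetric] t by (simp add: jacobian_def)
  ultimately show ?thesis
    by (simp add: material_acceleration_def)
qed

text \<open>Since the gradient of \<open>\<theta>\<close> is \<open>m\<close> times
  \<open>v\<close>, the product rule expands the divergence and the factor \<open>m\<close> cancels.
  This gives the identity at interior times; its left side is continuous in time, so it also
  vanishes at \<open>0\<close> and \<open>T\<close>.\<close>

lemma madelung_continuity_equation:
  fixes \<theta> \<rho> :: "real^'n \<Rightarrow> real \<Rightarrow> real"
  assumes m: "m > 0" and T: "T > 0"
    and eq: "madelung_equations m T \<rho>0 \<theta>0 \<rho> \<theta>" and v: "v = velocity m \<theta>"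
    and \<rho>: "\<And>t. t \<in> {0..T} \<Longrightarrow> (\<lambda>x. \<rho> x t) \<in> C_space 1" "\<rho> \<in> CC_loc 0 0 T"
    and g: "continuous_on (UNIV \<times> {0..T}) (\<lambda>z. g (fst z) (snd z))"
      "\<And>x t. t \<in> {0..T} \<Longrightarrow> ((\<lambda>s. \<rho> x s) has_real_derivative g x t) (at t within {0..T})"
      "continuous_on (UNIV \<times> {0..T}) (\<lambda>z. grad (\<lambda>y. \<rho> y (snd z)) (fst z))"
    and A: "continuous_on (UNIV \<times> {0..T}) (\<lambda>z. A (fst z) (snd z))"
      "continuous_on (UNIV \<times> {0..T}) (\<lambda>z. v (fst z) (snd z))"
      "\<And>x t. t \<in> {0..T} \<Longrightarrow> ((\<lambda>x. v x t) has_derivative (\<lambda>h. A x t *v h)) (at x)"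
    and t: "t \<in> {0..T}"
  shows "g x t + grad (\<lambda>y. \<rho> y t) x \<bullet> v x t + \<rho> x t * trace (A x t) = 0"
proof -
  let ?H = "\<lambda>t. g x t + grad (\<lambda>y. \<rho> y t) x \<bullet> v x t + \<rho> x t * trace (A x t)"
  have c: "continuous_on {0..T} (\<lambda>t. f x t)" if "continuous_on (UNIV \<times> {0..T}) (\<lambda>z. f (fst z) (snd z))" for f :: "_ \<Rightarrow> _ \<Rightarrow> 'b::topological_space"
    by (rule continuous_on_compose2[OF that, of "{0..T}" "\<lambda>t. (x, t)", simplified])
      (auto intro!: continuous_intros)
  have "continuous_on {0..T} ?H"
    using c[OF A(1)] unfolding trace_def
    by (intro continuous_intros c[OF CC_loc_0_continuous[OF \<rho>(2)]] c[OF A(2)] c[OF g(1)]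
        c[of "\<lambda>x t. grad (\<lambda>y. \<rho> y t) x", OF g(3)])
  moreover have "?H s = 0" if s: "s \<in> {0<..<T}" for s
  proof -
    have s': "s \<in> {0..T}" using s by auto
    have dr: "((\<lambda>y. \<rho> y s) has_derivative (\<lambda>h. grad (\<lambda>y. \<rho> y s) x \<bullet> h)) (at x)"
      using \<rho>(1)[OF s'] by (intro has_derivative_grad C_space_differentiable) simp
    have dv: "((\<lambda>y. v y s $ i) has_derivative (\<lambda>h. (A x s *v h) $ i)) (at x)" for i
      by (rule bounded_linear.has_derivative[OF bounded_linear_vec_nth A(3)[OF s']])
    have \<theta>: "grad (\<lambda>z. \<theta> z s) y $ i = m * v y s $ i" for y i
      using m by (simp add: v velocity_def)
    have "partial i (\<lambda>y. (\<rho> y s *\<^sub>R grad (\<lambda>z. \<theta> z s) y) $ i) x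
        = m * (grad (\<lambda>y. \<rho> y s) x $ i * v x s $ i + \<rho> x s * A x s $ i $ i)" for i
    proof -
      have "((\<lambda>y. \<rho> y s * (m * v y s $ i)) has_derivative
        (\<lambda>h. \<rho> x s * (m * (A x s *v h) $ i) + (grad (\<lambda>y. \<rho> y s) x \<bullet> h) * (m * v x s $ i))) (at x)"
        by (intro has_derivative_mult dr has_derivative_mult_right dv)
      from partial_eqI[OF this] show ?thesis
        by (simp add: \<theta> inner_axis matrix_vector_mul_component algebra_simps)
    qed
    then have "divergence (\<lambda>y. \<rho> y s *\<^sub>R grad (\<lambda>z. \<theta> z s) y) x
        = m * (grad (\<lambda>y. \<rho> y s) x \<bullet> v x s + \<rho> x s * trace (A x s))"
      by (simp add: divergence_def inner_vec_def trace_def sum.distrib sum_distrib_left algebra_simps)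
    moreover have "deriv (\<lambda>r. \<rho> x r) s = g x s"
    proof (rule DERIV_imp_deriv)
      have "((\<lambda>r. \<rho> x r) has_real_derivative g x s) (at s within {0<..<T})"
        by (rule DERIV_subset[OF g(2)[OF s']]) auto
      then show "((\<lambda>r. \<rho> x r) has_real_derivative g x s) (at s)"
        using s by (simp add: at_within_open[of s "{0<..<T}"])
    qed
    moreover have "deriv (\<lambda>r. \<rho> x r) s + (1 / m) * divergence (\<lambda>y. \<rho> y s *\<^sub>R grad (\<lambda>z. \<theta> z s) y) x = 0"
      using eq s unfolding madelung_equations_def by blast
    ultimately show ?thesis
      using m by (simp add: algebra_simps)
  qed
  ultimately show ?thesis
    using continuous_constant_on_closure[of "{0<..<T}" ?H 0 t] t T by simp
qed

section \<open>Flows of Lipschitz velocity fields\<close>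

text \<open>The bound on the absolute value of \<open>f'\<close> makes
  \<open>f t * exp (- K * t)\<close> nonincreasing and \<open>f t * exp (K * t)\<close>
  nondecreasing. The backward direction is what controls the inverse of the flow map.\<close>

lemma Gronwall_two_sided:
  fixes f :: "real \<Rightarrow> real"
  assumes cont: "continuous_on {0..T} f"
    and der: "\<And>t. t \<in> {0<..<T} \<Longrightarrow> (f has_real_derivative f' t) (at t)"
    and bound: "\<And>t. t \<in> {0<..<T} \<Longrightarrow> \<bar>f' t\<bar> \<le> K * f t"
    and s: "s \<in> {0..T}" and t: "t \<in> {0..T}"
  shows "f t \<le> exp (K * \<bar>t - s\<bar>) * f s"
proof (cases "s \<le> t")
  case True
  have "f s * exp (- K * s) \<ge> f t * exp (- K * t)"
  proof (rule DERIV_nonpos_imp_decreasing_open[OF True])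
    fix r
    assume "s < r" "r < t"
    then have r: "r \<in> {0<..<T}" using s t by auto
    have "((\<lambda>r. f r * exp (- K * r)) has_real_derivative (f' r - K * f r) * exp (- K * r)) (at r)"
      by (auto intro!: derivative_eq_intros der r simp: algebra_simps)
    moreover have "(f' r - K * f r) * exp (- K * r) \<le> 0"
      using bound[OF r] by (intro mult_nonpos_nonneg) auto
    ultimately show "\<exists>y. ((\<lambda>r. f r * exp (- K * r)) has_real_derivative y) (at r) \<and> y \<le> 0"
      by blast
  qed (use s t in \<open>auto intro!: continuous_intros continuous_on_subset[OF cont]\<close>)
  then have "f t * exp (- K * t) * exp (K * t) \<le> f s * exp (- K * s) * exp (K * t)"
    by simp
  moreover have "f t * exp (- K * t) * exp (K * t) = f t"
    by (simp add: exp_minus)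
  moreover have "exp (- K * s) * exp (K * t) = exp (K * \<bar>t - s\<bar>)"
    unfolding exp_add[symmetric] using True by (simp add: algebra_simps)
  ultimately show ?thesis by (metis mult.assoc mult.commute)
next
  case False
  then have ts: "t \<le> s" by simp
  have "f t * exp (K * t) \<le> f s * exp (K * s)"
  proof (rule DERIV_nonneg_imp_increasing_open[OF ts])
    fix r
    assume "t < r" "r < s"
    then have r: "r \<in> {0<..<T}" using s t by auto
    have "((\<lambda>r. f r * exp (K * r)) has_real_derivative (f' r + K * f r) * exp (K * r)) (at r)"
      by (auto intro!: derivative_eq_intros der r simp: algebra_simps)
    moreover have "(f' r + K * f r) * exp (K * r) \<ge> 0"
      using bound[OF r] by (intro mult_nonneg_nonneg) auto
    ultimately show "\<exists>y. ((\<lambda>r. f r * exp (K * r)) has_real_derivative y) (at r) \<and> y \<ge> 0"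
      by blast
  qed (use s t in \<open>auto intro!: continuous_intros continuous_on_subset[OF cont]\<close>)
  then have "f t * exp (K * t) * exp (- K * t) \<le> f s * exp (K * s) * exp (- K * t)"
    by simp
  moreover have "f t * exp (K * t) * exp (- K * t) = f t"
    by (simp add: exp_minus)
  moreover have "exp (K * s) * exp (- K * t) = exp (K * \<bar>t - s\<bar>)"
    unfolding exp_add[symmetric] using ts by (simp add: algebra_simps)
  ultimately show ?thesis by (metis mult.assoc mult.commute)
qed

text \<open>The bound on \<open>f'\<close> is required only at times no farther from
  \<open>s\<close> than \<open>t\<close> is. In \<open>X_Taylor\<close> this lets \<open>B\<close>
  itself be proportional to \<open>\<bar>t - s\<bar>\<close>, which yields a quadratic
  remainder.\<close>

lemma mean_value_bound_interior:
  fixes f :: "real \<Rightarrow> 'a::real_inner"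
  assumes cont: "continuous_on {0..T} f"
    and der: "\<And>t. t \<in> {0<..<T} \<Longrightarrow> (f has_vector_derivative f' t) (at t)"
    and bound: "\<And>r. r \<in> {0<..<T} \<Longrightarrow> \<bar>r - s\<bar> \<le> \<bar>t - s\<bar> \<Longrightarrow> norm (f' r) \<le> B"
    and s: "s \<in> {0..T}" and t: "t \<in> {0..T}"
  shows "norm (f t - f s) \<le> B * \<bar>t - s\<bar>"
proof -
  have *: "norm (f b - f a) \<le> B * (b - a)" if "a < b" "a = s \<and> b = t \<or> a = t \<and> b = s" for a b
  proof -
    have "\<exists>x\<in>{a<..<b}. norm (f b - f a) \<le> norm ((b - a) *\<^sub>R f' x)"
      by (rule mvt_general[OF that(1)])
        (use that s t der in \<open>auto simp: has_vector_derivative_def intro: continuous_on_subset[OF cont]\<close>)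
    then obtain x where x: "x \<in> {a<..<b}" "norm (f b - f a) \<le> (b - a) * norm (f' x)"
      using that by auto
    have "norm (f' x) \<le> B"
      using x that s t by (intro bound) auto
    then have "(b - a) * norm (f' x) \<le> (b - a) * B"
      using that by (intro mult_left_mono) auto
    with x(2) show ?thesis
      unfolding mult.commute[of B] by (rule order_trans)
  qed
  show ?thesis
    using *[of s t] *[of t s] by (cases s t rule: linorder_cases) (auto simp: norm_minus_commute)
qed

text \<open>Solving \<open>y = x + r x\<close> is finding the fixed point of
  \<open>\<lambda>x. y - r x\<close>. The lemma serves both the short-time flow and the explicit
  step \<open>E\<close>.\<close>

lemma bij_id_plus_contraction:
  fixes r :: "'a::banach \<Rightarrow> 'a"
  assumes c: "0 \<le> c" "c < 1" and r: "\<And>x y. norm (r x - r y) \<le> c * norm (x - y)"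
  shows "bij (\<lambda>x. x + r x)"
proof (rule bijI')
  fix x y
  show "x + r x = y + r y \<longleftrightarrow> x = y"
  proof
    assume "x + r x = y + r y"
    then have "x - y = - (r x - r y)"
      by (simp add: algebra_simps)
    then have "norm (x - y) \<le> c * norm (x - y)"
      by (metis norm_minus_cancel r)
    then have "(1 - c) * norm (x - y) \<le> 0"
      by (simp add: algebra_simps)
    then show "x = y"
      using c by (simp add: mult_le_0_iff)
  qed simp
next
  fix y
  have "dist (y - r x) (y - r x') \<le> c * dist x x'" for x x'
    using r[of x' x] by (simp add: dist_norm norm_minus_commute)
  then obtain x where "y - r x = x"
    using banach_fix_type[OF c, of "\<lambda>x. y - r x"] by blast
  then show "\<exists>x. y = x + r x"
    by (metis diff_add_cancel)
qed

lemma has_real_derivative_inner_self: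
  assumes "(d has_vector_derivative w) (at t within S)"
  shows "((\<lambda>t. d t \<bullet> d t) has_real_derivative 2 * (d t \<bullet> w)) (at t within S)"
proof -
  have "((\<lambda>t. d t \<bullet> d t) has_derivative (\<lambda>h. d t \<bullet> h *\<^sub>R w + h *\<^sub>R w \<bullet> d t)) (at t within S)"
    using assms unfolding has_vector_derivative_def by (intro has_derivative_inner)
  moreover have "(\<lambda>h. d t \<bullet> h *\<^sub>R w + h *\<^sub>R w \<bullet> d t) = (*) (2 * (d t \<bullet> w))"
    by (auto simp: inner_commute[of w])
  ultimately show ?thesis
    by (simp only: has_field_derivative_def)
qed

text \<open>\<open>acceleration\<close> states the bound on the material acceleration in integrated
  form, so that it makes sense up to the end times and needs no derivative of
  \<open>v\<close>.\<close>

locale lipschitz_flow =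
  fixes T L C M :: real
    and v :: "real^'n \<Rightarrow> real \<Rightarrow> real^'n"
    and X :: "real \<Rightarrow> real^'n \<Rightarrow> real^'n"
  assumes T_pos: "T > 0"
    and L_pos: "L > 0"
    and C_pos: "C > 0"
    and lipschitz: "\<And>x y t. t \<in> {0..T} \<Longrightarrow> norm (v x t - v y t) \<le> L * norm (x - y)"
    and growth: "\<And>x t. t \<in> {0..T} \<Longrightarrow> norm (v x t) \<le> C * (1 + norm x)"
    and flow: "characteristic_flow T v X"
    and acceleration: "\<And>x s t. s \<in> {0..T} \<Longrightarrow> t \<in> {0..T} \<Longrightarrow>
      norm (v (X s x) s - v (X t x) t) \<le> M * \<bar>s - t\<bar>"
begin

lemma X_0 [simp]: "X 0 x = x"
  and X_continuous: "continuous_on {0..T} (\<lambda>t. X t x)"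
  and X_deriv: "t \<in> {0<..<T} \<Longrightarrow> ((\<lambda>s. X s x) has_vector_derivative v (X t x) t) (at t)"
  using flow unfolding characteristic_flow_def by auto

lemma M_nonneg: "M \<ge> 0"
proof -
  have "0 \<le> norm (v (X T undefined) T - v (X 0 undefined) 0)"
    by simp
  also have "\<dots> \<le> M * T"
    using acceleration[of T 0 undefined] T_pos by simp
  finally show ?thesis
    using T_pos by (simp add: zero_le_mult_iff)
qed

text \<open>Gronwall is applied to the squared distance, which is differentiable even where the
  distance vanishes. As \<open>s\<close> and \<open>t\<close> are in any order, the estimate also
  gives injectivity and a Lipschitz bound for \<open>X t\<close> after
  \<open>inv (X s)\<close>.\<close>

lemma X_expansion:
  assumes s: "s \<in> {0..T}" and t: "t \<in> {0..T}"
  shows "norm (X t x - X t y) \<le> exp (L * T) * norm (X s x - X s y)"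
proof -
  let ?d = "\<lambda>t. X t x - X t y"
  have "?d t \<bullet> ?d t \<le> exp (2 * L * \<bar>t - s\<bar>) * (?d s \<bullet> ?d s)"
  proof (rule Gronwall_two_sided[where f = "\<lambda>t. ?d t \<bullet> ?d t", OF _ _ _ s t])
    show "continuous_on {0..T} (\<lambda>t. ?d t \<bullet> ?d t)"
      by (intro continuous_intros X_continuous)
    fix t
    assume t: "t \<in> {0<..<T}"
    let ?w = "v (X t x) t - v (X t y) t"
    show "((\<lambda>t. ?d t \<bullet> ?d t) has_real_derivative 2 * (?d t \<bullet> ?w)) (at t)"
      by (intro has_real_derivative_inner_self has_vector_derivative_diff X_deriv t)
    have "\<bar>?d t \<bullet> ?w\<bar> \<le> norm (?d t) * norm ?w"
      by (rule Cauchy_Schwarz_ineq2)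
    also have "\<dots> \<le> norm (?d t) * (L * norm (?d t))"
      using t by (intro mult_left_mono lipschitz) auto
    also have "\<dots> = L * (?d t \<bullet> ?d t)"
      by (simp add: dot_square_norm power2_eq_square)
    finally show "\<bar>2 * (?d t \<bullet> ?w)\<bar> \<le> 2 * L * (?d t \<bullet> ?d t)"
      by simp
  qed
  also have "\<dots> \<le> exp (2 * L * T) * (?d s \<bullet> ?d s)"
    using s t L_pos by (intro mult_right_mono) auto
  also have "exp (2 * L * T) = exp (L * T) ^ 2"
    by (simp add: power2_eq_square flip: exp_add)
  finally have "(norm (?d t))\<^sup>2 \<le> (exp (L * T) * norm (?d s))\<^sup>2"
    by (simp add: dot_square_norm power_mult_distrib)
  then show ?thesis
    by (rule power2_le_imp_le) simp
qed

text \<open>\<open>1 + norm^2\<close> is smooth and absorbs linear growth: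
  \<open>2 r + 2 r^2 \<le> 3 (1 + r^2)\<close>, whence the \<open>3\<close> in the exponent. Forward
  in time it propagates second moments, backward in time it bounds supports.\<close>

lemma X_growth:
  assumes s: "s \<in> {0..T}" and t: "t \<in> {0..T}"
  shows "1 + (norm (X t x))\<^sup>2 \<le> exp (3 * C * T) * (1 + (norm (X s x))\<^sup>2)"
proof -
  let ?f = "\<lambda>t. 1 + X t x \<bullet> X t x"
  have "?f t \<le> exp (3 * C * \<bar>t - s\<bar>) * ?f s"
  proof (rule Gronwall_two_sided[where f = ?f, OF _ _ _ s t])
    show "continuous_on {0..T} ?f"
      by (intro continuous_intros X_continuous)
    fix t
    assume t: "t \<in> {0<..<T}"
    let ?w = "v (X t x) t"
    show "(?f has_real_derivative 2 * (X t x \<bullet> ?w)) (at t)"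
      using has_real_derivative_inner_self[OF X_deriv[OF t, of x]]
      by (auto intro!: derivative_eq_intros)
    have "\<bar>X t x \<bullet> ?w\<bar> \<le> norm (X t x) * norm ?w"
      by (rule Cauchy_Schwarz_ineq2)
    also have "\<dots> \<le> norm (X t x) * (C * (1 + norm (X t x)))"
      using t by (intro mult_left_mono growth) auto
    finally have "\<bar>2 * (X t x \<bullet> ?w)\<bar> \<le> C * (2 * norm (X t x) + 2 * (norm (X t x))\<^sup>2)"
      by (simp add: power2_eq_square algebra_simps)
    also have "\<dots> \<le> C * (3 * (1 + (norm (X t x))\<^sup>2))"
    proof (rule mult_left_mono)
      have "0 \<le> (norm (X t x) - 1)\<^sup>2" by simp
      then show "2 * norm (X t x) + 2 * (norm (X t x))\<^sup>2 \<le> 3 * (1 + (norm (X t x))\<^sup>2)"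
        by (simp add: power2_diff)
    qed (use C_pos in simp)
    finally show "\<bar>2 * (X t x \<bullet> ?w)\<bar> \<le> 3 * C * ?f t"
      by (simp add: dot_square_norm algebra_simps)
  qed
  also have "\<dots> \<le> exp (3 * C * T) * ?f s"
    using s t C_pos by (intro mult_right_mono) (auto simp: add_nonneg_nonneg)
  finally show ?thesis
    by (simp add: dot_square_norm)
qed

lemma X_inj:
  assumes "t \<in> {0..T}"
  shows "inj (X t)"
proof (rule injI)
  fix x y
  assume "X t x = X t y"
  then show "x = y"
    using X_expansion[OF assms, of 0 x y] T_pos by simp
qed

text \<open>The flow is only given from time \<open>0\<close>, so characteristics cannot be traced back directly.
  Instead \<open>X\<^sub>t \<circ> inv X\<^sub>s\<close> is the identity plus a contraction when \<open>t\<close> is close to \<open>s\<close>, and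
  surjectivity propagates in finitely many steps.\<close>

lemma X_surj_step:
  assumes s: "s \<in> {0..T}" "surj (X s)" and t: "t \<in> {0..T}"
    and small: "L * exp (L * T) * \<bar>t - s\<bar> < 1"
  shows "surj (X t)"
proof -
  let ?Y = "inv (X s)"
  let ?r = "\<lambda>z. X t (?Y z) - X s (?Y z)"
  have Y: "X s (?Y z) = z" for z
    using s(2) by (rule surj_f_inv_f)
  have "bij (\<lambda>z. z + ?r z)"
  proof (rule bij_id_plus_contraction[OF _ small])
    fix z z'
    let ?d = "\<lambda>t. X t (?Y z) - X t (?Y z')"
    have "norm (?d t - ?d s) \<le> (L * exp (L * T) * norm (z - z')) * \<bar>t - s\<bar>"
    proof (rule mean_value_bound_interior[where f = ?d, OF _ _ _ s(1) t])
      show "continuous_on {0..T} ?d"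
        by (intro continuous_intros X_continuous)
      fix r
      assume r: "r \<in> {0<..<T}"
      show "(?d has_vector_derivative v (X r (?Y z)) r - v (X r (?Y z')) r) (at r)"
        by (intro has_vector_derivative_diff X_deriv r)
      have "norm (v (X r (?Y z)) r - v (X r (?Y z')) r) \<le> L * norm (?d r)"
        using r by (intro lipschitz) auto
      also have "\<dots> \<le> L * (exp (L * T) * norm (?d s))"
        using r L_pos s by (intro mult_left_mono X_expansion) auto
      finally show "norm (v (X r (?Y z)) r - v (X r (?Y z')) r) \<le> L * exp (L * T) * norm (z - z')"
        by (simp add: Y)
    qed
    then show "norm (?r z - ?r z') \<le> L * exp (L * T) * \<bar>t - s\<bar> * norm (z - z')"
      by (simp add: algebra_simps)
  qed (use L_pos in auto)
  then have "surj (\<lambda>z. X t (?Y z))"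
    by (simp add: Y bij_def)
  then show ?thesis
    unfolding surj_def by blast
qed

lemma X_surj:
  assumes t: "t \<in> {0..T}"
  shows "surj (X t)"
proof -
  \<comment> \<open>With \<open>n\<close> equal steps of length at most \<open>T / n\<close> each
    step meets the smallness condition of \<open>X_surj_step\<close>; the maximum with
    \<open>1\<close> keeps \<open>n\<close> positive.\<close>
  obtain n :: nat where n: "n > 0" "L * exp (L * T) * T < real n"
    using reals_Archimedean2[of "max 1 (L * exp (L * T) * T)"] by (metis max_less_iff_conj of_nat_0_less_iff zero_less_one order_less_trans)
  have le: "real k / real n * t \<in> {0..T}" if "k \<le> n" for k
    using that n t mult_mono[of "real k / real n" 1 t T] by (auto simp: divide_le_eq)
  have "surj (X (real k / real n * t))" if "k \<le> n" for k
    using that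
  proof (induction k)
    case (Suc k)
    have "\<bar>real (Suc k) / real n * t - real k / real n * t\<bar> = t / real n"
      using t n by (simp add: field_simps)
    then have "L * exp (L * T) * \<bar>real (Suc k) / real n * t - real k / real n * t\<bar> \<le> L * exp (L * T) * (T / real n)"
      using L_pos t n by (simp add: divide_right_mono)
    also have "\<dots> < 1"
      using n by (simp add: field_simps)
    finally show ?case
      using Suc by (intro X_surj_step[OF le[of k] _ le[of "Suc k"]]) auto
  qed (simp add: surj_def)
  from this[of n] n show ?thesis by simp
qed

text \<open>The linear part with frozen velocity is subtracted, and the remaining derivative is at
  most \<open>M * \<bar>t - s\<bar>\<close> between the two times. A second derivative in time is
  avoided; the price is the constant \<open>M\<close> in place of \<open>M / 2\<close>.\<close>

lemma X_Taylor:
  assumes s: "s \<in> {0..T}" and t: "t \<in> {0..T}"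
  shows "norm (X t x - (X s x + (t - s) *\<^sub>R v (X s x) s)) \<le> M * (t - s)\<^sup>2"
proof -
  let ?f = "\<lambda>r. X r x - (r - s) *\<^sub>R v (X s x) s"
  have "norm (?f t - ?f s) \<le> (M * \<bar>t - s\<bar>) * \<bar>t - s\<bar>"
  proof (rule mean_value_bound_interior[where f = ?f, OF _ _ _ s t])
    show "continuous_on {0..T} ?f"
      by (intro continuous_intros X_continuous)
    fix r
    assume r: "r \<in> {0<..<T}"
    show "(?f has_vector_derivative v (X r x) r - v (X s x) s) (at r)"
      by (auto intro!: derivative_eq_intros X_deriv r)
    assume "\<bar>r - s\<bar> \<le> \<bar>t - s\<bar>"
    then have "M * \<bar>r - s\<bar> \<le> M * \<bar>t - s\<bar>"
      using M_nonneg by (rule mult_left_mono)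
    then show "norm (v (X r x) r - v (X s x) s) \<le> M * \<bar>t - s\<bar>"
      using acceleration[of r s x] r s by auto
  qed
  moreover have "M * \<bar>t - s\<bar> * \<bar>t - s\<bar> = M * (t - s)\<^sup>2"
    by (simp add: power2_eq_square)
  ultimately show ?thesis
    by (simp add: algebra_simps)
qed

end

section \<open>Transport of densities\<close>

text \<open>Open boxes are an intersection-stable generator of the Borel sets, and the indicator of
  a box is the pointwise limit of the truncated multiples \<open>\<psi> n\<close> of the distance to
  its complement.\<close>

lemma measure_eqI_Lipschitz_test_functions:
  fixes M N :: "'a::euclidean_space measure"
  assumes sets: "sets M = sets borel" "sets N = sets borel"
    and fin: "finite_measure M" "finite_measure N"
    and eq: "\<And>\<psi> \<Lambda> R. (\<And>x y. \<bar>\<psi> x - \<psi> y\<bar> \<le> \<Lambda> * norm (x - y)) \<Longrightarrow> (\<And>x. R < norm x \<Longrightarrow> \<psi> x = 0) \<Longrightarrow>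
      (\<And>x. 0 \<le> \<psi> x \<and> \<psi> x \<le> 1) \<Longrightarrow> (\<integral>x. \<psi> x \<partial>M) = (\<integral>x. \<psi> x \<partial>N)"
  shows "M = N"
proof (rule measure_eqI_generator_eq)
  interpret M: finite_measure M by fact
  interpret N: finite_measure N by fact
  let ?E = "range (\<lambda>(a, b). box a b::'a set)"
  show "Int_stable ?E"
    by (auto simp: Int_stable_def box_Int_box)
  show "?E \<subseteq> Pow UNIV" "sets M = sigma_sets UNIV ?E" "sets N = sigma_sets UNIV ?E"
    by (simp_all add: borel_eq_box sets)
  let ?A = "\<lambda>n::nat. box (- (real n *\<^sub>R One)) (real n *\<^sub>R One) :: 'a set"
  show "range ?A \<subseteq> ?E" "(\<Union>i. ?A i) = UNIV"
    unfolding UN_box_eq_UNIV by auto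
  show "emeasure M (?A i) \<noteq> \<infinity>" for i
    by auto
  fix U
  assume "U \<in> ?E"
  then obtain l u where U: "U = box l u" by auto
  obtain R where R: "\<And>x. x \<in> U \<Longrightarrow> norm x \<le> R"
    using bounded_box[of l u] unfolding bounded_iff U by blast
  have cl: "closed (- U)"
    unfolding closed_def U by (simp add: open_box)
  \<comment> \<open>\<open>infdist\<close> to the empty set is \<open>0\<close> by convention, so
    positivity inside \<open>U\<close> needs a nonempty complement.\<close>
  have "- U \<noteq> {}"
    using bounded_box[of l u] not_bounded_UNIV U by (metis Compl_empty_eq double_compl)
  then have pos: "infdist x (- U) > 0 \<longleftrightarrow> x \<in> U" for x
    using in_closed_iff_infdist_zero[OF cl, of x] infdist_nonneg[of x "- U"] by auto
  define \<psi> where "\<psi> n x = min 1 (real n * infdist x (- U))" for n x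
  have \<psi>01: "0 \<le> \<psi> n x \<and> \<psi> n x \<le> 1" for n x
    by (auto simp: \<psi>_def infdist_nonneg)
  have \<psi>0: "\<psi> n x = 0" if "x \<notin> U" for n x
    using pos[of x] that infdist_nonneg[of x "- U"] by (auto simp: \<psi>_def)
  have int: "(\<integral>x. \<psi> n x \<partial>M) = (\<integral>x. \<psi> n x \<partial>N)" for n
  proof (rule eq[OF _ _ \<psi>01])
    show "\<bar>\<psi> n x - \<psi> n y\<bar> \<le> real n * norm (x - y)" for x y
    proof -
      have "\<bar>real n * infdist x (- U) - real n * infdist y (- U)\<bar> = real n * \<bar>infdist x (- U) - infdist y (- U)\<bar>"
        by (simp add: abs_mult flip: right_diff_distrib)
      also have "\<dots> \<le> real n * norm (x - y)"
        by (metis infdist_triangle_abs dist_norm mult_left_mono of_nat_0_le_iff)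
      finally show ?thesis
        unfolding \<psi>_def by linarith
    qed
    show "\<psi> n x = 0" if "R < norm x" for x
      using R[of x] that by (intro \<psi>0) auto
  qed
  have lim: "(\<lambda>n. \<psi> n x) \<longlonglongrightarrow> indicator U x" for x
  proof (cases "x \<in> U")
    case True
    then obtain n where n: "1 < real n * infdist x (- U)"
      using pos[of x] ex_less_of_nat_mult by blast
    have "\<psi> k x = 1" if "n \<le> k" for k
    proof -
      have "real n * infdist x (- U) \<le> real k * infdist x (- U)"
        using that by (intro mult_right_mono infdist_nonneg) simp
      with n show ?thesis
        by (simp add: \<psi>_def)
    qed
    with True show ?thesis
      by (intro tendsto_eventually) (auto simp: eventually_sequentially)
  qed (simp add: \<psi>0)
  have meas: "\<psi> n \<in> borel_measurable borel" for n
    unfolding \<psi>_def by (intro borel_measurable_continuous_onI continuous_intros)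
  have Uborel: "U \<in> sets borel"
    by (simp add: U)
  have M: "(\<lambda>n. \<integral>x. \<psi> n x \<partial>M) \<longlonglongrightarrow> (\<integral>x. indicator U x \<partial>M)"
    by (rule integral_dominated_convergence[where w = "\<lambda>_. 1"])
      (use sets Uborel \<psi>01 lim meas in \<open>auto cong: measurable_cong_sets\<close>)
  have N: "(\<lambda>n. \<integral>x. \<psi> n x \<partial>N) \<longlonglongrightarrow> (\<integral>x. indicator U x \<partial>N)"
    by (rule integral_dominated_convergence[where w = "\<lambda>_. 1"])
      (use sets Uborel \<psi>01 lim meas in \<open>auto cong: measurable_cong_sets\<close>)
  have "measure M U = measure N U"
    using LIMSEQ_unique[OF M N[folded int]] sets sets_eq_imp_space_eq[OF sets(1)] sets_eq_imp_space_eq[OF sets(2)]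
    by simp
  then show "emeasure M U = emeasure N U"
    by (simp add: M.emeasure_eq_measure N.emeasure_eq_measure)
qed

lemma integrable_bounded_support:
  fixes f :: "'a::euclidean_space \<Rightarrow> real"
  assumes "continuous_on UNIV f" "\<And>x. R < norm x \<Longrightarrow> f x = 0"
  shows "integrable lborel f"
proof -
  have "integrable lborel (\<lambda>x. indicator (cball 0 R) x *\<^sub>R f x)"
    by (intro borel_integrable_compact continuous_on_subset[OF assms(1)]) auto
  moreover have "(\<lambda>x. indicator (cball 0 R) x *\<^sub>R f x) = f"
    using assms(2) by (auto simp: fun_eq_iff indicator_def)
  ultimately show ?thesis by simp
qed

section \<open>First-order expansion of Jacobian determinant and density\<close>

lemma bounded_linear_trace: "bounded_linear (trace :: real^'n^'n \<Rightarrow> real)"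
  using has_derivative_det by (rule has_derivative_bounded_linear)

text \<open>\<open>det\<close> is positive near the identity matrix, so the absolute value from the
  change of variables does not affect the derivative there.\<close>

lemma has_derivative_abs_det:
  "((\<lambda>B :: real^'n^'n. \<bar>det B\<bar>) has_derivative trace) (at (mat 1))"
proof (rule has_derivative_transform_within_open[OF has_derivative_det])
  have "continuous_on UNIV (det :: real^'n^'n \<Rightarrow> real)"
    unfolding det_def[abs_def] by (intro continuous_intros)
  then show "open {B :: real^'n^'n. 0 < det B}"
    by (intro open_Collect_less) auto
qed auto

text \<open>One derivative at \<open>mat 1\<close> serves all \<open>x\<close> at once, because the
  perturbations \<open>(s - t) A x\<close> shrink uniformly when \<open>A\<close> is bounded on
  \<open>K\<close>. The tolerance \<open>e / (2 * a)\<close> leaves an error of at most half of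
  \<open>e * \<bar>s - t\<bar>\<close>.\<close>

lemma abs_det_uniform_limit:
  fixes A :: "'a \<Rightarrow> real^'n^'n"
  assumes "bounded (A ` K)"
  shows "uniform_limit K (\<lambda>s x. (\<bar>det (mat 1 + (s - t) *\<^sub>R A x)\<bar> - 1) / (s - t)) (\<lambda>x. trace (A x)) (at t within S)"
proof (rule uniform_limitI)
  fix e :: real
  assume e: "e > 0"
  obtain a where a: "a > 0" "\<And>x. x \<in> K \<Longrightarrow> norm (A x) \<le> a"
    using assms unfolding bounded_pos by auto
  obtain d where d: "d > 0" "\<And>B :: real^'n^'n. norm (B - mat 1) < d \<Longrightarrow>
      norm (\<bar>det B\<bar> - \<bar>det (mat 1 :: real^'n^'n)\<bar> - trace (B - mat 1)) \<le> e / (2 * a) * norm (B - mat 1)"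
    using has_derivative_abs_det[where 'n = 'n] e a(1) unfolding has_derivative_at_alt
    by (metis divide_pos_pos mult_pos_pos zero_less_numeral)
  have "dist ((\<bar>det (mat 1 + (s - t) *\<^sub>R A x)\<bar> - 1) / (s - t)) (trace (A x)) < e"
    if s: "s \<noteq> t" "dist s t < d / a" and x: "x \<in> K" for s x
  proof -
    let ?h = "s - t"
    have h: "\<bar>?h\<bar> > 0" using s by simp
    have n: "norm (?h *\<^sub>R A x) \<le> \<bar>?h\<bar> * a"
      using a(2)[OF x] by (simp add: mult_left_mono)
    also have "\<dots> < d"
      using s a by (simp add: dist_real_def pos_less_divide_eq)
    finally have "norm ((mat 1 + ?h *\<^sub>R A x) - mat 1) < d"
      by simp
    from d(2)[OF this] have "\<bar>\<bar>det (mat 1 + ?h *\<^sub>R A x)\<bar> - 1 - ?h * trace (A x)\<bar> \<le> e / (2 * a) * norm (?h *\<^sub>R A x)"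
      by (simp add: det_I linear_cmul[OF bounded_linear.linear[OF bounded_linear_trace]])
    also have "\<dots> \<le> e / (2 * a) * (\<bar>?h\<bar> * a)"
      using n e a by (intro mult_left_mono) auto
    also have "\<dots> < e * \<bar>?h\<bar>"
      using a e h by simp
    finally have "\<bar>\<bar>det (mat 1 + ?h *\<^sub>R A x)\<bar> - 1 - ?h * trace (A x)\<bar> / \<bar>?h\<bar> < e"
      using h by (simp add: pos_divide_less_eq)
    moreover have "(\<bar>det (mat 1 + ?h *\<^sub>R A x)\<bar> - 1) / ?h - trace (A x)
        = (\<bar>det (mat 1 + ?h *\<^sub>R A x)\<bar> - 1 - ?h * trace (A x)) / ?h"
      using s by (simp add: diff_divide_distrib)
    ultimately show ?thesis
      by (simp add: dist_real_def abs_divide)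
  qed
  then show "\<forall>\<^sub>F s in at t within S. \<forall>x\<in>K. dist ((\<bar>det (mat 1 + (s - t) *\<^sub>R A x)\<bar> - 1) / (s - t)) (trace (A x)) < e"
    unfolding eventually_at using d a by (intro exI[of _ "d / a"]) auto
qed

text \<open>The limit is the space-time derivative of \<open>\<rho>\<close> in direction
  \<open>(u x, 1)\<close>, that is, the time derivative plus the advection by
  \<open>u\<close>.\<close>

lemma transport_uniform_limit:
  fixes \<rho> :: "'a::euclidean_space \<Rightarrow> real \<Rightarrow> real" and u :: "'a \<Rightarrow> 'a"
  assumes D: "\<And>z. z \<in> UNIV \<times> {0..T} \<Longrightarrow> ((\<lambda>z. \<rho> (fst z) (snd z)) has_derivative (\<lambda>h. D z \<bullet> h)) (at z within UNIV \<times> {0..T})"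
    and cont: "continuous_on (UNIV \<times> {0..T}) D"
    and t: "t \<in> {0..T}" and K: "bounded K" and u: "bounded (u ` K)"
  shows "uniform_limit K (\<lambda>s x. (\<rho> (x + (s - t) *\<^sub>R u x) s - \<rho> x t) / (s - t)) (\<lambda>x. D (x, t) \<bullet> (u x, 1)) (at t within {0..T})"
proof (rule uniform_limitI)
  fix e :: real
  assume e: "e > 0"
  obtain R where R: "\<And>x. x \<in> K \<Longrightarrow> norm x \<le> R"
    using K unfolding bounded_iff by auto
  obtain V where V: "V > 0" "\<And>x. x \<in> K \<Longrightarrow> norm (u x) \<le> V"
    using u unfolding bounded_pos by auto
  \<comment> \<open>The space-time displacement has norm at most
    \<open>\<bar>s - t\<bar> * (V + 1)\<close>, so this tolerance leaves half of
    \<open>e\<close>.\<close>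
  define e' where "e' = e / (2 * (V + 1))"
  have "e' > 0"
    using e V by (simp add: e'_def)
  from C1_uniform_linearization[where f = "\<lambda>z. \<rho> (fst z) (snd z)", OF D cont this, of R]
  obtain \<delta> where \<delta>: "\<delta> > 0"
    "\<And>x t y s. norm x \<le> R \<Longrightarrow> t \<in> {0..T} \<Longrightarrow> s \<in> {0..T} \<Longrightarrow> norm (y - x) \<le> \<delta> \<Longrightarrow> \<bar>s - t\<bar> \<le> \<delta> \<Longrightarrow>
       \<bar>\<rho> y s - \<rho> x t - D (x, t) \<bullet> (y - x, s - t)\<bar> \<le> e' * norm (y - x, s - t)"
    by auto
  have "dist ((\<rho> (x + (s - t) *\<^sub>R u x) s - \<rho> x t) / (s - t)) (D (x, t) \<bullet> (u x, 1)) < e"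
    if s: "s \<in> {0..T}" "s \<noteq> t" "dist s t < \<delta> / (V + 1)" and x: "x \<in> K" for s x
  proof -
    let ?h = "s - t" let ?y = "x + (s - t) *\<^sub>R u x"
    have h: "\<bar>?h\<bar> > 0" using s by simp
    have hV: "\<bar>?h\<bar> * (V + 1) < \<delta>"
      using s V by (simp add: dist_real_def pos_less_divide_eq)
    have n: "norm (?y - x) \<le> \<bar>?h\<bar> * V"
      using V(2)[OF x] by (simp add: mult_left_mono)
    have "\<bar>?h\<bar> * V \<ge> 0"
      using V by simp
    then have "norm (?y - x) \<le> \<delta>" "\<bar>?h\<bar> \<le> \<delta>"
      using n hV by (auto simp: algebra_simps)
    then have "\<bar>\<rho> ?y s - \<rho> x t - D (x, t) \<bullet> (?y - x, ?h)\<bar> \<le> e' * norm (?y - x, ?h)"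
      using s t by (intro \<delta>(2) R x) auto
    also have "norm (?y - x, ?h) \<le> norm (?y - x) + norm ?h"
      by (rule norm_Pair_le)
    also have "\<dots> \<le> \<bar>?h\<bar> * (V + 1)"
      using n by (simp add: algebra_simps)
    also have "e' * (\<bar>?h\<bar> * (V + 1)) = e / 2 * \<bar>?h\<bar>"
      using V by (simp add: e'_def field_simps)
    also have "\<dots> < e * \<bar>?h\<bar>"
      using e h by simp
    finally have "\<bar>\<rho> ?y s - \<rho> x t - D (x, t) \<bullet> (?y - x, ?h)\<bar> / \<bar>?h\<bar> < e"
      using h \<open>e' > 0\<close> by (simp add: pos_divide_less_eq)
    moreover have "D (x, t) \<bullet> (?y - x, ?h) = ?h * (D (x, t) \<bullet> (u x, 1))"
      by (simp add: inner_prod_def algebra_simps)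
    then have "(\<rho> ?y s - \<rho> x t) / ?h - D (x, t) \<bullet> (u x, 1)
        = (\<rho> ?y s - \<rho> x t - D (x, t) \<bullet> (?y - x, ?h)) / ?h"
      using s by (simp add: diff_divide_distrib)
    ultimately show ?thesis
      by (simp add: dist_real_def abs_divide)
  qed
  then show "\<forall>\<^sub>F s in at t within {0..T}. \<forall>x\<in>K.
      dist ((\<rho> (x + (s - t) *\<^sub>R u x) s - \<rho> x t) / (s - t)) (D (x, t) \<bullet> (u x, 1)) < e"
    unfolding eventually_at using \<delta> V by (intro exI[of _ "\<delta> / (V + 1)"]) auto
qed

text \<open>A discrete product rule: with \<open>h = s - t\<close>,
  \<open>(J p - \<rho>) / h = (J - 1) / h * p + (p - \<rho>) / h\<close>. The limit is
  \<open>trace A * \<rho>\<close> plus the derivative of \<open>\<rho>\<close> along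
  \<open>(u, 1)\<close>, and the continuity equation makes it vanish.\<close>

lemma Jacobian_density_uniform_limit:
  fixes \<rho> :: "real^'n \<Rightarrow> real \<Rightarrow> real" and u :: "real^'n \<Rightarrow> real^'n" and A :: "real^'n \<Rightarrow> real^'n^'n"
  assumes D: "\<And>z. z \<in> UNIV \<times> {0..T} \<Longrightarrow> ((\<lambda>z. \<rho> (fst z) (snd z)) has_derivative (\<lambda>h. D z \<bullet> h)) (at z within UNIV \<times> {0..T})"
    and cont: "continuous_on (UNIV \<times> {0..T}) D"
    and t: "t \<in> {0..T}" and K: "compact K" and u: "continuous_on UNIV u" and A: "continuous_on UNIV A"
    and eq: "\<And>x. D (x, t) \<bullet> (u x, 1) + \<rho> x t * trace (A x) = 0"
  shows "uniform_limit K (\<lambda>s x. (\<bar>det (mat 1 + (s - t) *\<^sub>R A x)\<bar> * \<rho> (x + (s - t) *\<^sub>R u x) s - \<rho> x t) / (s - t))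
    (\<lambda>_. 0) (at t within {0..T})"
proof -
  let ?F = "at t within {0..T}"
  let ?J = "\<lambda>s x. \<bar>det (mat 1 + (s - t) *\<^sub>R A x)\<bar>"
  let ?p = "\<lambda>s x. \<rho> (x + (s - t) *\<^sub>R u x) s"
  let ?q = "\<lambda>x. D (x, t) \<bullet> (u x, 1)"
  have bd: "bounded (f ` K)" if "continuous_on UNIV f" for f :: "real^'n \<Rightarrow> 'b::metric_space"
    using that K by (intro compact_imp_bounded compact_continuous_image) (auto intro: continuous_on_subset)
  have cD: "continuous_on UNIV (\<lambda>x. D (x, t))"
    by (rule continuous_on_compose2[OF cont]) (use t in \<open>auto intro!: continuous_intros\<close>)
  have bq: "bounded (?q ` K)"
    by (intro bd continuous_intros cD u)
  have "continuous_on (UNIV \<times> {0..T}) (\<lambda>z. \<rho> (fst z) (snd z))"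
    unfolding continuous_on_eq_continuous_within by (intro ballI has_derivative_continuous[OF D])
  from continuous_on_compose2[OF this, of UNIV "\<lambda>x. (x, t)"]
  have "continuous_on UNIV (\<lambda>x. \<rho> x t)"
    using t by (simp add: continuous_on_Pair image_subset_iff)
  then have b\<rho>: "bounded ((\<lambda>x. \<rho> x t) ` K)"
    by (rule bd)
  have bt: "bounded ((\<lambda>x. trace (A x)) ` K)"
    by (intro bd linear_continuous_on_compose[OF A] bounded_linear.linear[OF bounded_linear_trace])
  have 1: "uniform_limit K (\<lambda>s x. (?p s x - \<rho> x t) / (s - t)) ?q ?F"
    by (intro transport_uniform_limit[OF D cont t compact_imp_bounded[OF K] bd[OF u]])
  have 2: "uniform_limit K (\<lambda>s x. (?J s x - 1) / (s - t)) (\<lambda>x. trace (A x)) ?F"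
    by (intro abs_det_uniform_limit bd A)
  have 3: "uniform_limit K (\<lambda>s x. s - t) (\<lambda>x. 0) ?F"
  proof (rule uniform_limitI)
    fix e :: real
    assume "e > 0"
    then show "\<forall>\<^sub>F s in ?F. \<forall>x\<in>K. dist (s - t) 0 < e"
      unfolding eventually_at by (intro exI[of _ e]) (auto simp: dist_real_def)
  qed
  \<comment> \<open>Convergence of \<open>?p\<close> itself is recovered from that of its difference
    quotient by multiplying with \<open>s - t\<close>.\<close>
  have "uniform_limit K (\<lambda>s x. \<rho> x t + (s - t) * ((?p s x - \<rho> x t) / (s - t))) (\<lambda>x. \<rho> x t + 0 * ?q x) ?F"
    by (rule uniform_limit_add[OF uniform_limit_const uniform_lim_mult[OF 3 1 _ bq]])
      (rule bounded_subset[of "{0}"], auto)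
  then have 4: "uniform_limit K ?p (\<lambda>x. \<rho> x t) ?F"
    by (rule uniform_limit_cong[THEN iffD1, rotated 2]) (auto simp: eventually_at_filter)
  have "uniform_limit K (\<lambda>s x. (?J s x - 1) / (s - t) * ?p s x + (?p s x - \<rho> x t) / (s - t))
      (\<lambda>x. trace (A x) * \<rho> x t + ?q x) ?F"
    by (rule uniform_limit_add[OF uniform_lim_mult[OF 2 4 bt b\<rho>] 1])
  moreover have "(?J s x - 1) / (s - t) * ?p s x + (?p s x - \<rho> x t) / (s - t) = (?J s x * ?p s x - \<rho> x t) / (s - t)" for s x
    by (simp add: left_diff_distrib flip: add_divide_distrib)
  moreover have "trace (A x) * \<rho> x t + ?q x = 0" for x
    using eq[of x] by (simp add: mult.commute)
  ultimately show ?thesis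
    by simp
qed

lemma prob_density_measure:
  assumes "prob_density f"
  shows "prob_space (density_measure f)" "integrable lborel f" "(\<integral>x. f x \<partial>lborel) = 1"
    "sets (density_measure f) = sets borel"
proof -
  have f: "f \<in> borel_measurable borel" "\<And>x. 0 \<le> f x" "(\<integral>\<^sup>+x. ennreal (f x) \<partial>lborel) = 1"
    using assms unfolding prob_density_def by auto
  show "prob_space (density_measure f)"
    unfolding density_measure_def using f by (intro prob_spaceI) (simp add: emeasure_density)
  show "integrable lborel f"
    using f by (intro integrableI_nonneg) auto
  show "(\<integral>x. f x \<partial>lborel) = 1"
    using f by (intro integral_eq_nn_integral[THEN trans]) auto
  show "sets (density_measure f) = sets borel"
    by (simp add: density_measure_def)
qed

section \<open>Test functions carried along the flow\<close>

context lipschitz_flow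
begin

text \<open>This plays the part of the solution of the backward transport equation with terminal
  value \<open>\<psi>\<close>: it is constant along characteristics, equal to \<open>\<psi>\<close>
  at time \<open>T\<close> and to \<open>\<psi>\<close> after \<open>X T\<close> at time
  \<open>0\<close>.\<close>

definition transported :: "(real^'n \<Rightarrow> real) \<Rightarrow> real \<Rightarrow> real^'n \<Rightarrow> real" where
  "transported \<psi> t y = \<psi> (X T (inv (X t) y))"

lemma X_inv:
  assumes "t \<in> {0..T}"
  shows "X t (inv (X t) y) = y" "inv (X t) (X t z) = z"
  using surj_f_inv_f[OF X_surj[OF assms]] inv_f_f[OF X_inj[OF assms]] by simp_all

lemma transported_X: "t \<in> {0..T} \<Longrightarrow> transported \<psi> t (X t z) = \<psi> (X T z)"
  by (simp add: transported_def X_inv)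

lemma transported_Lipschitz:
  assumes \<psi>: "\<And>x y. \<bar>\<psi> x - \<psi> y\<bar> \<le> \<Lambda> * norm (x - y)" and \<Lambda>: "\<Lambda> \<ge> 0" and t: "t \<in> {0..T}"
  shows "\<bar>transported \<psi> t x - transported \<psi> t y\<bar> \<le> \<Lambda> * exp (L * T) * norm (x - y)"
proof -
  have "norm (X T (inv (X t) x) - X T (inv (X t) y)) \<le> exp (L * T) * norm (x - y)"
    using X_expansion[of t T "inv (X t) x" "inv (X t) y"] t T_pos by (simp add: X_inv[OF t])
  then have "\<Lambda> * norm (X T (inv (X t) x) - X T (inv (X t) y)) \<le> \<Lambda> * (exp (L * T) * norm (x - y))"
    using \<Lambda> by (rule mult_left_mono)
  then show ?thesis
    unfolding transported_def using \<psi>[of "X T (inv (X t) x)" "X T (inv (X t) y)"] by (simp add: mult.assoc)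
qed

text \<open>If \<open>X T z\<close> lies in the ball of radius \<open>R\<close>, the backward growth
  estimate bounds \<open>X t z\<close> by a radius independent of \<open>t\<close>. The crude
  inequality \<open>r \<le> 1 + r^2\<close> avoids a square root in that radius.\<close>

lemma transported_support:
  assumes \<psi>: "\<And>x. R < norm x \<Longrightarrow> \<psi> x = 0" and t: "t \<in> {0..T}"
    and y: "exp (3 * C * T) * (1 + R\<^sup>2) < norm y"
  shows "transported \<psi> t y = 0"
proof (rule ccontr)
  let ?z = "inv (X t) y"
  assume "transported \<psi> t y \<noteq> 0"
  then have "norm (X T ?z) \<le> R"
    using \<psi>[of "X T ?z"] unfolding transported_def by (meson not_less)
  then have R: "(norm (X T ?z))\<^sup>2 \<le> R\<^sup>2"
    by (intro power_mono) auto
  have "0 \<le> (norm y - 1)\<^sup>2" by simp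
  then have "2 * norm y \<le> 1 + (norm y)\<^sup>2"
    by (simp add: power2_diff)
  then have "norm y \<le> 1 + (norm y)\<^sup>2"
    using norm_ge_zero[of y] by linarith
  also have "\<dots> = 1 + (norm (X t ?z))\<^sup>2"
    by (simp add: X_inv[OF t])
  also have "\<dots> \<le> exp (3 * C * T) * (1 + (norm (X T ?z))\<^sup>2)"
    using X_growth[of T t ?z] t T_pos by simp
  also have "\<dots> \<le> exp (3 * C * T) * (1 + R\<^sup>2)"
    using R by simp
  finally show False
    using y by simp
qed

end

text \<open>\<open>D\<close> is the space-time gradient of \<open>\<rho>\<close>, so
  \<open>D (x, t) \<bullet> (v x t, 1)\<close> is the derivative of the density along the velocity
  and \<open>continuity_equation\<close> is the non-divergence form.\<close>

locale lipschitz_transport = lipschitz_flow T L C M v X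
  for T L C M :: real
    and v :: "real^'n \<Rightarrow> real \<Rightarrow> real^'n"
    and X :: "real \<Rightarrow> real^'n \<Rightarrow> real^'n" +
  fixes \<rho> :: "real^'n \<Rightarrow> real \<Rightarrow> real"
    and D :: "(real^'n) \<times> real \<Rightarrow> (real^'n) \<times> real"
    and A :: "real^'n \<Rightarrow> real \<Rightarrow> real^'n^'n"
  assumes \<rho>_deriv: "\<And>z. z \<in> UNIV \<times> {0..T} \<Longrightarrow>
      ((\<lambda>z. \<rho> (fst z) (snd z)) has_derivative (\<lambda>h. D z \<bullet> h)) (at z within UNIV \<times> {0..T})"
    and D_continuous: "continuous_on (UNIV \<times> {0..T}) D"
    and v_deriv: "\<And>x t. t \<in> {0..T} \<Longrightarrow> ((\<lambda>x. v x t) has_derivative (\<lambda>h. A x t *v h)) (at x)"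
    and A_continuous: "\<And>t. t \<in> {0..T} \<Longrightarrow> continuous_on UNIV (\<lambda>x. A x t)"
    and continuity_equation: "\<And>x t. t \<in> {0..T} \<Longrightarrow> D (x, t) \<bullet> (v x t, 1) + \<rho> x t * trace (A x t) = 0"
    and density: "\<And>t. t \<in> {0..T} \<Longrightarrow> prob_density (\<lambda>x. \<rho> x t)"
begin

lemma v_continuous: "t \<in> {0..T} \<Longrightarrow> continuous_on UNIV (\<lambda>x. v x t)"
  by (rule has_derivative_continuous_on[OF v_deriv])

lemma \<rho>_continuous:
  assumes "t \<in> {0..T}"
  shows "continuous_on UNIV (\<lambda>x. \<rho> x t)"
proof -
  have "continuous_on (UNIV \<times> {0..T}) (\<lambda>z. \<rho> (fst z) (snd z))"
    unfolding continuous_on_eq_continuous_within by (intro ballI has_derivative_continuous[OF \<rho>_deriv])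
  from continuous_on_compose2[OF this, of UNIV "\<lambda>x. (x, t)"] show ?thesis
    using assms by (simp add: continuous_on_Pair image_subset_iff)
qed

text \<open>The smallness of the step makes the displacement a contraction, so \<open>E\<close> is a
  bijection of the whole space although only its local derivative is prescribed.\<close>

lemma Euler_step_change_of_variables:
  assumes t: "t \<in> {0..T}" and s: "s \<in> {0..T}" and h: "L * \<bar>s - t\<bar> < 1"
    and f: "continuous_on UNIV f" "integrable lborel f"
  defines "E \<equiv> \<lambda>x. x + (s - t) *\<^sub>R v x t"
    and "J \<equiv> \<lambda>x. \<bar>det (mat 1 + (s - t) *\<^sub>R A x t)\<bar>"
  shows "integrable lborel (\<lambda>x. J x * f (E x))" "(\<integral>x. J x * f (E x) \<partial>lborel) = (\<integral>x. f x \<partial>lborel)"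
proof -
  have bij: "bij E"
    unfolding E_def
  proof (rule bij_id_plus_contraction[OF _ h])
    fix x y
    have "norm ((s - t) *\<^sub>R v x t - (s - t) *\<^sub>R v y t) = \<bar>s - t\<bar> * norm (v x t - v y t)"
      by (simp flip: scaleR_diff_right)
    also have "\<dots> \<le> \<bar>s - t\<bar> * (L * norm (x - y))"
      by (intro mult_left_mono lipschitz t) auto
    finally show "norm ((s - t) *\<^sub>R v x t - (s - t) *\<^sub>R v y t) \<le> L * \<bar>s - t\<bar> * norm (x - y)"
      by (simp add: mult_ac)
  qed (use L_pos in auto)
  have deriv: "(E has_derivative (\<lambda>k. (mat 1 + (s - t) *\<^sub>R A x t) *v k)) (at x)" for x
    unfolding E_def
    by (auto intro!: derivative_eq_intros v_deriv t simp: matrix_vector_mult_add_rdistrib scaleR_matrix_vector_assoc)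
  have cont: "continuous_on UNIV (\<lambda>x. mat 1 + (s - t) *\<^sub>R A x t)"
    by (intro continuous_intros A_continuous t)
  show "integrable lborel (\<lambda>x. J x * f (E x))" "(\<integral>x. J x * f (E x) \<partial>lborel) = (\<integral>x. f x \<partial>lborel)"
    unfolding J_def using lborel_change_of_variables[OF bij deriv cont f] by simp_all
qed

lemma transported_integral_derivative:
  fixes \<psi> :: "real^'n \<Rightarrow> real"
  assumes Lip: "\<And>x y. \<bar>\<psi> x - \<psi> y\<bar> \<le> \<Lambda> * norm (x - y)"
    and supp: "\<And>x. R < norm x \<Longrightarrow> \<psi> x = 0"
    and \<psi>01: "\<And>x. 0 \<le> \<psi> x \<and> \<psi> x \<le> 1"
    and t: "t \<in> {0..T}"
  shows "((\<lambda>t. \<integral>x. transported \<psi> t x * \<rho> x t \<partial>lborel) has_real_derivative 0) (at t within {0..T})"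
proof -
  let ?P = "transported \<psi>"
  define F where "F t = (\<integral>x. ?P t x * \<rho> x t \<partial>lborel)" for t
  have \<Lambda>: "\<Lambda> \<ge> 0"
  proof -
    \<comment> \<open>\<open>axis undefined 1\<close> is some unit vector; the Lipschitz bound at
      two distinct points forces the sign of \<open>\<Lambda>\<close>.\<close>
    have "0 \<le> \<Lambda> * norm (axis undefined 1 - 0 :: real^'n)"
      using Lip[of "axis undefined 1" 0] by (meson abs_ge_zero order_trans)
    then show ?thesis by simp
  qed
  define \<Lambda>' where "\<Lambda>' = \<Lambda> * exp (L * T)"
  have \<Lambda>': "\<Lambda>' \<ge> 0"
    using \<Lambda> by (simp add: \<Lambda>'_def)
  have P_Lip: "\<bar>?P s x - ?P s y\<bar> \<le> \<Lambda>' * norm (x - y)" if "s \<in> {0..T}" for s x y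
    unfolding \<Lambda>'_def by (rule transported_Lipschitz[OF Lip \<Lambda> that])
  have P_cont: "continuous_on UNIV (?P s)" if "s \<in> {0..T}" for s
    using P_Lip[OF that] \<Lambda>' by (intro lipschitz_on_continuous_on[of \<Lambda>'] lipschitz_onI) (auto simp: dist_norm)
  define R1 where "R1 = exp (3 * C * T) * (1 + R\<^sup>2)"
  have P_supp: "?P s y = 0" if "s \<in> {0..T}" "R1 < norm y" for s y
    by (rule transported_support[where R = R, OF _ that(1)]) (use supp that(2) in \<open>auto simp: R1_def\<close>)
  have P01: "\<bar>?P s y\<bar> \<le> 1" for s y
    using \<psi>01 by (simp add: transported_def)
  have prod_cont: "continuous_on UNIV (\<lambda>x. ?P s x * \<rho> x s)" if "s \<in> {0..T}" for s
    using that by (intro continuous_intros P_cont \<rho>_continuous)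
  have prod_int: "integrable lborel (\<lambda>x. ?P s x * \<rho> x s)" if "s \<in> {0..T}" for s
    using that P_supp[of s] by (intro integrable_bounded_support[of _ R1] prod_cont) auto
  \<comment> \<open>Once \<open>C * \<bar>s - t\<bar> < 1 / 2\<close>, a point outside
    \<open>K\<close> has \<open>norm (?E s x) \<ge> (norm x - 1) / 2 > R1\<close>, so the
    transported test function vanishes at its image.\<close>
  define K where "K = cball (0 :: real^'n) (2 * R1 + 1)"
  define vol where "vol = measure lborel K"
  have K_int: "integrable lborel (indicator K :: real^'n \<Rightarrow> real)" "(\<integral>x. indicator K x \<partial>lborel) = vol"
    using emeasure_lborel_cball_finite[of "0 :: real^'n" "2 * R1 + 1"]
    by (auto simp: K_def vol_def)
  have vol: "vol \<ge> 0"
    by (simp add: vol_def)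
  note \<rho>1 = prob_density_measure[OF density[OF t]]
  have dominating: "integrable lborel (\<lambda>x. indicator K x * c + \<rho> x t * d)"
    "(\<integral>x. indicator K x * c + \<rho> x t * d \<partial>lborel) = vol * c + d" for c d :: real
  proof -
    have 1: "integrable lborel (\<lambda>x. indicator K x * c)" and 2: "integrable lborel (\<lambda>x. \<rho> x t * d)"
      using K_int(1) \<rho>1(2) by (simp_all only: integrable_mult_left)
    show "integrable lborel (\<lambda>x. indicator K x * c + \<rho> x t * d)"
      by (rule Bochner_Integration.integrable_add[OF 1 2])
    show "(\<integral>x. indicator K x * c + \<rho> x t * d \<partial>lborel) = vol * c + d"
      unfolding Bochner_Integration.integral_add[OF 1 2] integral_mult_left_zero K_int(2) \<rho>1(3) by simp
  qed
  have \<rho>0: "\<rho> x t \<ge> 0" for x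
    using density[OF t] by (simp add: prob_density_def)
  let ?E = "\<lambda>s x. x + (s - t) *\<^sub>R v x t"
  let ?J = "\<lambda>s x. \<bar>det (mat 1 + (s - t) *\<^sub>R A x t)\<bar>"
  have ulim: "uniform_limit K (\<lambda>s x. (?J s x * \<rho> (?E s x) s - \<rho> x t) / (s - t)) (\<lambda>_. 0) (at t within {0..T})"
    by (rule Jacobian_density_uniform_limit[OF \<rho>_deriv D_continuous t _ v_continuous[OF t] A_continuous[OF t]
          continuity_equation[OF t]]) (simp_all add: K_def)
  have "((\<lambda>s. (F s - F t) / (s - t)) \<longlongrightarrow> 0) (at t within {0..T})"
  proof (rule tendstoI)
    fix e :: real
    assume e: "e > 0"
    \<comment> \<open>The \<open>+ 1\<close> avoids a division by zero and makes
      \<open>e1 * vol < e / 2\<close> strict; the other half of \<open>e\<close> is left for the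
      quadratic error.\<close>
    define e1 where "e1 = e / (2 * (vol + 1))"
    have e1: "e1 > 0" "e1 * vol < e / 2"
      using e vol by (auto simp: e1_def field_simps)
    have ev1: "\<forall>\<^sub>F s in at t within {0..T}. \<forall>x\<in>K. \<bar>(?J s x * \<rho> (?E s x) s - \<rho> x t) / (s - t)\<bar> < e1"
      using uniform_limitD[OF ulim e1(1)] by simp
    have small: "\<forall>\<^sub>F s in at t within {0..T}. c * \<bar>s - t\<bar> < b" if "b > 0" for b c :: real
    proof (rule order_tendstoD)
      have "((\<lambda>s. c * \<bar>s - t\<bar>) \<longlongrightarrow> c * \<bar>t - t\<bar>) (at t within {0..T})"
        by (intro tendsto_intros)
      then show "((\<lambda>s. c * \<bar>s - t\<bar>) \<longlongrightarrow> 0) (at t within {0..T})"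
        by simp
    qed (rule that)
    \<comment> \<open>The three conditions give, in order, bijectivity of the step, control of
      supports outside \<open>K\<close>, and smallness of the quadratic error after division by the
      step length.\<close>
    have ev2: "\<forall>\<^sub>F s in at t within {0..T}. L * \<bar>s - t\<bar> < 1 \<and> C * \<bar>s - t\<bar> < 1 / 2 \<and> \<Lambda>' * M * \<bar>s - t\<bar> < e / 2"
      using e by (intro eventually_conj small) auto
    have ev3: "\<forall>\<^sub>F s in at t within {0..T}. s \<in> {0..T} \<and> s \<noteq> t"
      by (auto simp: eventually_at_filter)
    from ev1 ev2 ev3 show "\<forall>\<^sub>F s in at t within {0..T}. dist ((F s - F t) / (s - t)) 0 < e"
    proof eventually_elim
      case (elim s)
      then have s: "s \<in> {0..T}" and h: "\<bar>s - t\<bar> > 0" by auto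
      let ?h = "\<bar>s - t\<bar>"
      have cov: "integrable lborel (\<lambda>x. ?J s x * (?P s (?E s x) * \<rho> (?E s x) s))"
        "(\<integral>x. ?J s x * (?P s (?E s x) * \<rho> (?E s x) s) \<partial>lborel) = F s"
        using Euler_step_change_of_variables[OF t s _ prod_cont[OF s] prod_int[OF s]] elim
        by (auto simp: F_def)
      have pointwise: "\<bar>?J s x * (?P s (?E s x) * \<rho> (?E s x) s) - ?P t x * \<rho> x t\<bar>
          \<le> indicator K x * (e1 * ?h) + \<rho> x t * (\<Lambda>' * M * ?h\<^sup>2)" for x
      proof -
        let ?z = "inv (X t) x"
        \<comment> \<open>Constancy along characteristics moves the value at time \<open>t\<close>
          to time \<open>s\<close>, so only the distance between the flow and the explicit step
          enters.\<close>
        have Pt: "?P t x = ?P s (X s ?z)"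
          unfolding transported_X[OF s] by (simp add: transported_def)
        have "norm (X s ?z - ?E s x) \<le> M * (s - t)\<^sup>2"
          using X_Taylor[OF t s, of ?z] by (simp add: X_inv[OF t])
        then have "\<Lambda>' * norm (?E s x - X s ?z) \<le> \<Lambda>' * (M * ?h\<^sup>2)"
          using \<Lambda>' by (intro mult_left_mono) (simp_all add: norm_minus_commute)
        with P_Lip[OF s, of "?E s x" "X s ?z"] have I2: "\<bar>?P s (?E s x) - ?P t x\<bar> \<le> \<Lambda>' * M * ?h\<^sup>2"
          unfolding Pt by (simp add: mult.assoc)
        have I1: "\<bar>?P s (?E s x) * (?J s x * \<rho> (?E s x) s - \<rho> x t)\<bar> \<le> indicator K x * (e1 * ?h)"
        proof (cases "x \<in> K")
          case True
          then have "\<bar>(?J s x * \<rho> (?E s x) s - \<rho> x t) / (s - t)\<bar> < e1"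
            using elim by blast
          then have "\<bar>?J s x * \<rho> (?E s x) s - \<rho> x t\<bar> \<le> e1 * ?h"
            using h by (simp add: abs_divide pos_divide_less_eq)
          then have "\<bar>?P s (?E s x)\<bar> * \<bar>?J s x * \<rho> (?E s x) s - \<rho> x t\<bar> \<le> 1 * (e1 * ?h)"
            by (intro mult_mono P01) auto
          with True show ?thesis
            by (simp add: abs_mult)
        next
          case False
          then have x: "2 * R1 + 1 < norm x"
            by (simp add: K_def)
          have "norm ((s - t) *\<^sub>R v x t) \<le> ?h * (C * (1 + norm x))"
            using growth[OF t, of x] by (simp add: mult_left_mono)
          also have "\<dots> = (C * ?h) * (1 + norm x)"
            by simp
          also have "\<dots> \<le> 1 / 2 * (1 + norm x)"
            using elim by (intro mult_right_mono) auto
          finally have "norm x - 1 / 2 * (1 + norm x) \<le> norm (?E s x)"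
            using norm_diff_ineq[of x "(s - t) *\<^sub>R v x t"] by linarith
          then have "R1 < norm (?E s x)"
            using x by (simp add: field_simps)
          then show ?thesis
            using P_supp[OF s] False by simp
        qed
        \<comment> \<open>The first summand carries the error of the density and lives on
          \<open>K\<close>; the second carries the error of the flow and is weighted by
          \<open>\<rho> x t\<close>, whose integral is \<open>1\<close>, so it needs no
          compactness.\<close>
        have eq: "?J s x * (?P s (?E s x) * \<rho> (?E s x) s) - ?P t x * \<rho> x t
            = ?P s (?E s x) * (?J s x * \<rho> (?E s x) s - \<rho> x t) + \<rho> x t * (?P s (?E s x) - ?P t x)"
          by (simp add: algebra_simps)
        show ?thesis
          unfolding eq using I1 mult_left_mono[OF I2 \<rho>0[of x]] \<rho>0[of x]
          by (intro order_trans[OF abs_triangle_ineq] add_mono) (auto simp: abs_mult)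
      qed
      have eq: "F s - F t = (\<integral>x. ?J s x * (?P s (?E s x) * \<rho> (?E s x) s) - ?P t x * \<rho> x t \<partial>lborel)"
        using cov prod_int[OF t] by (simp add: F_def)
      have "norm (F s - F t) \<le> vol * (e1 * ?h) + \<Lambda>' * M * ?h\<^sup>2"
        unfolding eq dominating(2)[symmetric]
      proof (rule Bochner_Integration.integral_norm_bound_integral[OF
            Bochner_Integration.integrable_diff[OF cov(1) prod_int[OF t]] dominating(1)])
        fix x
        show "norm (?J s x * (?P s (?E s x) * \<rho> (?E s x) s) - ?P t x * \<rho> x t)
            \<le> indicator K x * (e1 * ?h) + \<rho> x t * (\<Lambda>' * M * ?h\<^sup>2)"
          using pointwise[of x] by (simp only: real_norm_def)
      qed
      also have "\<dots> = (e1 * vol + \<Lambda>' * M * ?h) * ?h"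
        by (simp only: power2_eq_square distrib_left distrib_right mult_ac)
      also have "\<dots> < e * ?h"
      proof (rule mult_strict_right_mono[OF _ h])
        show "e1 * vol + \<Lambda>' * M * ?h < e"
          using elim e1(2) by linarith
      qed
      finally show ?case
        using h by (simp add: abs_divide pos_divide_less_eq)
    qed
  qed
  then show ?thesis
    unfolding has_field_derivative_iff F_def .
qed

text \<open>The constant function \<open>F\<close> is read off at its two ends: at \<open>T\<close>
  it integrates \<open>\<psi>\<close> against the final density, at \<open>0\<close> it integrates
  \<open>\<psi>\<close> after \<open>X T\<close> against the initial one.\<close>

theorem pushforward_density:
  "density_measure (\<lambda>x. \<rho> x T) = distr (density_measure (\<lambda>x. \<rho> x 0)) borel (X T)"
proof -
  have 0: "0 \<in> {0..T}" and T: "T \<in> {0..T}"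
    using T_pos by auto
  note \<rho>0 = prob_density_measure[OF density[OF 0]] and \<rho>T = prob_density_measure[OF density[OF T]]
  have "(exp (L * T))-lipschitz_on UNIV (X T)"
    using X_expansion[OF 0 T] by (intro lipschitz_onI) (auto simp: dist_norm)
  then have XT: "X T \<in> borel_measurable borel"
    by (intro borel_measurable_continuous_onI lipschitz_on_continuous_on)
  have meas: "(\<lambda>x. \<rho> x t) \<in> borel_measurable borel" "\<And>x. 0 \<le> \<rho> x t" if "t \<in> {0..T}" for t
    using density[OF that] by (auto simp: prob_density_def)
  interpret p0: prob_space "density_measure (\<lambda>x. \<rho> x 0)" by (rule \<rho>0(1))
  interpret pT: prob_space "density_measure (\<lambda>x. \<rho> x T)" by (rule \<rho>T(1))
  have XT': "X T \<in> density_measure (\<lambda>x. \<rho> x 0) \<rightarrow>\<^sub>M borel"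
    using XT by (simp add: density_measure_def)
  interpret pX: prob_space "distr (density_measure (\<lambda>x. \<rho> x 0)) borel (X T)"
    by (rule p0.prob_space_distr[OF XT'])
  show ?thesis
  proof (rule measure_eqI_Lipschitz_test_functions)
    fix \<psi> :: "real^'n \<Rightarrow> real" and \<Lambda> R
    assume \<psi>: "\<And>x y. \<bar>\<psi> x - \<psi> y\<bar> \<le> \<Lambda> * norm (x - y)" "\<And>x. R < norm x \<Longrightarrow> \<psi> x = 0"
      "\<And>x. 0 \<le> \<psi> x \<and> \<psi> x \<le> 1"
    let ?F = "\<lambda>t. \<integral>x. transported \<psi> t x * \<rho> x t \<partial>lborel"
    have "\<exists>c. \<forall>t\<in>{0..T}. ?F t = c"
      by (rule has_field_derivative_zero_constant) (use transported_integral_derivative[OF \<psi>] in auto)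
    then have eq: "?F T = ?F 0"
      using 0 T by metis
    \<comment> \<open>The test lemma fixes no sign for \<open>\<Lambda>\<close>, while
      \<open>lipschitz_on\<close> demands a nonnegative constant.\<close>
    have "\<bar>\<psi> x - \<psi> y\<bar> \<le> \<bar>\<Lambda>\<bar> * norm (x - y)" for x y
      using \<psi>(1)[of x y] mult_right_mono[OF abs_ge_self[of \<Lambda>] norm_ge_zero[of "x - y"]] by (rule order_trans)
    then have "(\<bar>\<Lambda>\<bar>)-lipschitz_on UNIV \<psi>"
      by (intro lipschitz_onI) (auto simp: dist_norm)
    then have \<psi>m: "\<psi> \<in> borel_measurable borel"
      by (intro borel_measurable_continuous_onI lipschitz_on_continuous_on)
    have "(\<integral>x. \<psi> x \<partial>density_measure (\<lambda>x. \<rho> x T)) = ?F T"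
      unfolding density_measure_def transported_def
      using \<psi>m meas[OF T] by (subst integral_density) (auto simp: X_inv[OF T] mult.commute)
    also have "?F T = ?F 0" by (rule eq)
    also have "?F 0 = (\<integral>x. \<psi> (X T x) \<partial>density_measure (\<lambda>x. \<rho> x 0))"
      unfolding density_measure_def
      using \<psi>m XT meas[OF 0] transported_X[OF 0, of \<psi>]
      by (subst integral_density) (auto simp: mult.commute)
    also have "\<dots> = (\<integral>x. \<psi> x \<partial>distr (density_measure (\<lambda>x. \<rho> x 0)) borel (X T))"
      using \<psi>m XT' by (subst integral_distr) auto
    finally show "(\<integral>x. \<psi> x \<partial>density_measure (\<lambda>x. \<rho> x T)) = (\<integral>x. \<psi> x \<partial>distr (density_measure (\<lambda>x. \<rho> x 0)) borel (X T))" .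
  qed (auto simp: \<rho>T(4) intro: p0.finite_measure_axioms pT.finite_measure_axioms pX.finite_measure_axioms)
qed

end

section \<open>Error of the free transport approximation\<close>

text \<open>A strict superlevel set of a continuous function is open in \<open>S\<close>, hence
  either empty or of positive measure. The pointwise bound is what can be evaluated along a
  characteristic.\<close>

lemma norm_le_Linf_norm_of_continuous:
  fixes f :: "'a::euclidean_space \<Rightarrow> 'b::real_normed_vector"
  assumes S: "open S" and f: "continuous_on S f" and x: "x \<in> S"
  shows "ennreal (norm (f x)) \<le> Linf_norm (lebesgue_on S) f"
proof (rule ccontr)
  let ?c = "Linf_norm (lebesgue_on S) f"
  assume "\<not> ennreal (norm (f x)) \<le> ?c"
  then have lt: "?c < ennreal (norm (f x))"
    by simp
  then have fin: "?c \<noteq> \<infinity>"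
    by auto
  define c where "c = enn2real ?c"
  have c: "?c = ennreal c" "c \<ge> 0"
    using fin by (auto simp: c_def less_top)
  have "c < norm (f x)"
    using lt c by (simp add: ennreal_less_iff)
  let ?U = "{y \<in> S. c < norm (f y)}"
  have "open ?U"
  proof -
    have "open (S \<inter> (\<lambda>y. norm (f y)) -` {c<..})"
      by (intro continuous_open_preimage continuous_intros f S)
    moreover have "S \<inter> (\<lambda>y. norm (f y)) -` {c<..} = ?U"
      by auto
    ultimately show ?thesis by simp
  qed
  moreover have "?U \<noteq> {}"
    using x \<open>c < norm (f x)\<close> by auto
  ultimately have "\<not> negligible ?U"
    by (rule open_not_negligible)
  moreover have "negligible ?U"
  proof -
    have "AE y in lebesgue_on S. ennreal (norm (f y)) \<le> ?c"
      unfolding Linf_norm_def by (rule esssup_AE)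
    then have "AE y in lebesgue. y \<in> S \<longrightarrow> ennreal (norm (f y)) \<le> ennreal c"
      using S by (simp add: AE_restrict_space_iff c(1))
    then have "AE y in lebesgue. y \<in> - ?U"
      by (rule AE_mp) (use c(2) in \<open>auto simp: not_less\<close>)
    then show ?thesis
      by (simp add: completion.AE_iff_null_sets negligible_iff_null_sets null_sets_completion_subset Compl_eq)
  qed
  ultimately show False by blast
qed

text \<open>Under the joint law of \<open>F\<close> and \<open>G\<close> the cost is at most
  \<open>c powr p\<close> everywhere, and \<open>\<mu>\<close> has mass one, so the
  \<open>p\<close>-th root returns the same \<open>c\<close> for every \<open>p\<close>.\<close>

lemma wasserstein_distr_le:
  fixes F G :: "real^'n \<Rightarrow> real^'n"
  assumes \<mu>: "prob_space \<mu>" "sets \<mu> = sets borel"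
    and F: "F \<in> borel_measurable borel" and G: "G \<in> borel_measurable borel"
    and c: "c \<ge> 0" "\<And>x. norm (F x - G x) \<le> c" and p: "p > 0"
  shows "wasserstein p (distr \<mu> borel F) (distr \<mu> borel G) \<le> ennreal c"
proof -
  interpret prob_space \<mu> by (rule \<mu>(1))
  have [measurable]: "F \<in> \<mu> \<rightarrow>\<^sub>M borel" "G \<in> \<mu> \<rightarrow>\<^sub>M borel"
    using F G \<mu>(2) by (simp_all cong: measurable_cong_sets)
  let ?H = "\<lambda>x. (F x, G x)"
  define \<pi> where "\<pi> = distr \<mu> borel ?H"
  have H: "?H \<in> \<mu> \<rightarrow>\<^sub>M borel"
    by (intro borel_measurable_Pair) measurable
  have "\<pi> \<in> couplings (distr \<mu> borel F) (distr \<mu> borel G)"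
    unfolding couplings_def \<pi>_def using H
    by (auto intro!: prob_space_distr simp: distr_distr o_def borel_measurable_continuous_onI continuous_on_fst continuous_on_snd)
  moreover have "ennreal_root p (\<integral>\<^sup>+z. ennreal (norm (fst z - snd z) powr p) \<partial>\<pi>) \<le> ennreal c"
  proof -
    let ?I = "\<integral>\<^sup>+z. ennreal (norm (fst z - snd z) powr p) \<partial>\<pi>"
    have m: "(\<lambda>z::(real^'n) \<times> (real^'n). ennreal (norm (fst z - snd z) powr p)) \<in> borel_measurable borel"
      by (simp add: borel_prod[symmetric])
    have "?I = (\<integral>\<^sup>+x. ennreal (norm (F x - G x) powr p) \<partial>\<mu>)"
      unfolding \<pi>_def by (subst nn_integral_distr[OF H]) (use m in simp_all)
    also have "\<dots> \<le> (\<integral>\<^sup>+x. ennreal (c powr p) \<partial>\<mu>)"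
      using p c by (intro nn_integral_mono ennreal_leI powr_mono2) auto
    also have "\<dots> = ennreal (c powr p)"
      by (simp add: emeasure_space_1)
    finally have I: "?I \<le> ennreal (c powr p)" .
    then have fin: "?I \<noteq> \<infinity>"
      by (auto simp: top_unique)
    have "enn2real ?I \<le> c powr p"
      using I by (intro enn2real_leI) auto
    then have "enn2real ?I powr (1 / p) \<le> (c powr p) powr (1 / p)"
      using p by (intro powr_mono2) auto
    also have "\<dots> = c"
      using p c(1) by (simp add: powr_powr)
    finally show ?thesis
      using fin by (simp add: ennreal_root_def ennreal_leI)
  qed
  ultimately show ?thesis
    unfolding wasserstein_def by (rule INF_lower2)
qed

lemma distr_in_P_space_2:
  fixes F :: "real^'n \<Rightarrow> real^'n"
  assumes \<mu>: "\<mu> \<in> P_space 2" and F: "F \<in> borel_measurable borel"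
    and growth: "\<And>x. 1 + (norm (F x))\<^sup>2 \<le> B * (1 + (norm x)\<^sup>2)"
  shows "distr \<mu> borel F \<in> P_space 2"
proof -
  have sets: "sets \<mu> = sets borel" and prob: "prob_space \<mu>" and fin: "(\<integral>\<^sup>+x. ennreal (norm x powr 2) \<partial>\<mu>) < \<infinity>"
    using \<mu> by (auto simp: P_space_def)
  interpret prob_space \<mu> by (rule prob)
  have F': "F \<in> \<mu> \<rightarrow>\<^sub>M borel"
    using F sets by (simp cong: measurable_cong_sets)
  have m: "(\<lambda>x::real^'n. ennreal (norm x powr 2)) \<in> borel_measurable \<mu>"
    using sets by (simp cong: measurable_cong_sets)
  have B: "B \<ge> 0"
  proof -
    have "1 + (norm (F 0))\<^sup>2 \<le> B"
      using growth[of 0] by simp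
    moreover have "0 \<le> (norm (F 0))\<^sup>2"
      by simp
    ultimately show ?thesis by linarith
  qed
  have "(\<integral>\<^sup>+y. ennreal (norm y powr 2) \<partial>distr \<mu> borel F) = (\<integral>\<^sup>+x. ennreal (norm (F x) powr 2) \<partial>\<mu>)"
    by (subst nn_integral_distr[OF F']) auto
  also have "\<dots> \<le> (\<integral>\<^sup>+x. ennreal B + ennreal B * ennreal (norm x powr 2) \<partial>\<mu>)"
  proof (rule nn_integral_mono)
    fix x
    have "norm (F x) powr 2 \<le> B + B * norm x powr 2"
      using growth[of x] by (simp add: powr_numeral distrib_left)
    then show "ennreal (norm (F x) powr 2) \<le> ennreal B + ennreal B * ennreal (norm x powr 2)"
      using B by (simp flip: ennreal_mult ennreal_plus)
  qed
  also have "\<dots> = ennreal B + ennreal B * (\<integral>\<^sup>+x. ennreal (norm x powr 2) \<partial>\<mu>)"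
    using m by (simp add: nn_integral_add nn_integral_cmult emeasure_space_1)
  also have "\<dots> < \<infinity>"
    using fin by (simp add: ennreal_mult_less_top)
  finally show ?thesis
    using prob_space_distr[OF F'] by (simp add: P_space_def)
qed

text \<open>Two fields appear because \<open>a\<close>, built from two-sided time derivatives, is
  tied to \<open>b\<close> only at interior times, whereas \<open>b\<close> is continuous up to the
  end times and supplies integrability. The last conclusion is the form of the bound required by
  \<open>lipschitz_flow\<close>.\<close>

lemma characteristic_Taylor_formula:
  fixes v :: "real^'n \<Rightarrow> real \<Rightarrow> real^'n"
  assumes T: "T > 0" and flow: "characteristic_flow T v X"
    and v_cont: "continuous_on (UNIV \<times> {0..T}) (\<lambda>z. v (fst z) (snd z))"
    and b_cont: "continuous_on (UNIV \<times> {0..T}) (\<lambda>z. b (fst z) (snd z))"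
    and deriv: "\<And>t. t \<in> {0<..<T} \<Longrightarrow> ((\<lambda>s. v (X s x) s) has_vector_derivative b (X t x) t) (at t)"
    and a: "\<And>t. t \<in> {0<..<T} \<Longrightarrow> a (X t x) t = b (X t x) t"
    and bound: "\<And>t. t \<in> {0<..<T} \<Longrightarrow> norm (a (X t x) t) \<le> M"
  shows "set_integrable lborel {0<..<T} (\<lambda>t. (T - t) *\<^sub>R a (X t x) t)"
    and "X T x - (x + T *\<^sub>R v x 0) = (LBINT t:{0<..<T}. (T - t) *\<^sub>R a (X t x) t)"
    and "norm (X T x - (x + T *\<^sub>R v x 0)) \<le> T\<^sup>2 / 2 * M"
    and "\<And>s t. s \<in> {0..T} \<Longrightarrow> t \<in> {0..T} \<Longrightarrow> norm (v (X s x) s - v (X t x) t) \<le> M * \<bar>s - t\<bar>"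
proof -
  have X: "X 0 x = x" "continuous_on {0..T} (\<lambda>t. X t x)"
    "\<And>t. t \<in> {0<..<T} \<Longrightarrow> ((\<lambda>s. X s x) has_vector_derivative v (X t x) t) (at t)"
    using flow unfolding characteristic_flow_def by auto
  have along: "continuous_on {0..T} (\<lambda>t. f (X t x) t)"
    if "continuous_on (UNIV \<times> {0..T}) (\<lambda>z. f (fst z) (snd z))" for f :: "real^'n \<Rightarrow> real \<Rightarrow> real^'n"
    using continuous_on_compose2[OF that, of "{0..T}" "\<lambda>t. (X t x, t)"] X(2)
    by (simp add: continuous_on_Pair image_subset_iff)
  let ?a = "\<lambda>t. (T - t) *\<^sub>R a (X t x) t"
  let ?b = "\<lambda>t. (T - t) *\<^sub>R b (X t x) t"
  have "set_integrable lborel {0..T} ?b"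
    by (intro borel_integrable_atLeastAtMost' continuous_intros along b_cont)
  then have "set_integrable lborel {0<..<T} ?b"
    by (rule set_integrable_subset) auto
  then show int: "set_integrable lborel {0<..<T} ?a"
    by (rule set_integrable_cong[THEN iffD1, rotated 3]) (auto simp: a)
  let ?G = "\<lambda>t. X t x + (T - t) *\<^sub>R v (X t x) t"
  have "(?a has_integral ?G T - ?G 0) {0..T}"
  proof (rule fundamental_theorem_of_calculus_interior)
    show "continuous_on {0..T} ?G"
      by (intro continuous_intros X(2) along v_cont)
    fix t
    assume t: "t \<in> {0<..<T}"
    show "(?G has_vector_derivative ?a t) (at t)"
      using a[OF t] by (auto intro!: derivative_eq_intros X(3) deriv t)
  qed (use T in simp)
  then have hi: "(?a has_integral X T x - (x + T *\<^sub>R v x 0)) {0<..<T}"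
    by (simp add: X(1) has_integral_Icc_iff_Ioo algebra_simps)
  then show "X T x - (x + T *\<^sub>R v x 0) = (LBINT t:{0<..<T}. ?a t)"
    using set_borel_integral_eq_integral(2)[OF int] by (simp add: integral_unique)
  \<comment> \<open>The antiderivative is \<open>- (T - t)^2 / 2 * M\<close>; the factor
    \<open>T^2 / 2\<close> is the integral of the weight \<open>T - t\<close>.\<close>
  have "((\<lambda>t. (T - t) * M) has_integral - ((T - T)\<^sup>2 / 2 * M) - - ((T - 0)\<^sup>2 / 2 * M)) {0..T}"
    by (rule fundamental_theorem_of_calculus)
      (use T in \<open>auto intro!: derivative_eq_intros simp: field_simps has_real_derivative_iff_has_vector_derivative[symmetric]\<close>)
  then have hM: "((\<lambda>t. (T - t) * M) has_integral T\<^sup>2 / 2 * M) {0<..<T}"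
    by (simp add: has_integral_Icc_iff_Ioo)
  have "norm (integral {0<..<T} ?a) \<le> integral {0<..<T} (\<lambda>t. (T - t) * M)"
  proof (rule integral_norm_bound_integral)
    show "norm (?a t) \<le> (T - t) * M" if "t \<in> {0<..<T}" for t
      using bound[OF that] that by (auto intro!: mult_left_mono)
  qed (use hi hM in auto)
  then show "norm (X T x - (x + T *\<^sub>R v x 0)) \<le> T\<^sup>2 / 2 * M"
    unfolding integral_unique[OF hi] integral_unique[OF hM] .
  show "norm (v (X s x) s - v (X t x) t) \<le> M * \<bar>s - t\<bar>" if "s \<in> {0..T}" "t \<in> {0..T}" for s t
  proof (rule mean_value_bound_interior[where f = "\<lambda>t. v (X t x) t", OF _ deriv _ that(2) that(1)])
    show "norm (b (X r x) r) \<le> M" if "r \<in> {0<..<T}" for r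
      using bound[OF that] a[OF that] by simp
  qed (auto intro: along v_cont)
qed

theorem theorem4p1:
  fixes m T c0 L C :: real
    and v0 :: "real^'n \<Rightarrow> real^'n"
    and \<phi>0 \<theta>0 \<rho>0 :: "real^'n \<Rightarrow> real"
    and \<rho> \<theta> :: "real^'n \<Rightarrow> real \<Rightarrow> real"
    and v a :: "real^'n \<Rightarrow> real \<Rightarrow> real^'n"
    and X :: "real \<Rightarrow> real^'n \<Rightarrow> real^'n"
    and X_tilde :: "real^'n \<Rightarrow> real^'n"
    and \<mu>0 \<mu>T \<mu>_tilde :: "(real^'n) measure"
    and a_norm :: ennreal
  assumes "m > 0" and "T > 0"
    and "v0 \<in> C_space_vec 1"
    and "(\<lambda>x. jacobian v0 (at x)) \<in> Linf lebesgue"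
    and "\<phi>0 \<in> C_space 2"
    and "v0 = grad \<phi>0"
    and "\<theta>0 = (\<lambda>x. m * \<phi>0 x + c0)"
    and "\<forall>x. \<rho>0 x > 0"
    and "prob_density \<rho>0"
    and "\<mu>0 = density_measure \<rho>0"
    and "\<mu>0 \<in> P_space 2"
    and "unique_madelung_solution m T \<rho>0 \<theta>0 \<rho> \<theta>"
    and "\<forall>x. \<forall>t\<in>{0..T}. \<rho> x t > 0"
    and "\<rho> \<in> CC_loc 0 3 T"
    and "\<theta> \<in> CC_loc 1 1 T"
    and "v = velocity m \<theta>"
    and "L > 0"
    and "\<forall>x y. \<forall>t\<in>{0..T}. norm (v x t - v y t) \<le> L * norm (x - y)"
    and "C > 0"
    and "\<forall>x. \<forall>t\<in>{0..T}. norm (v x t) \<le> C * (1 + norm x)"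
    and "a = material_acceleration v"
    and "(\<lambda>(x, t). a x t) \<in> Linf (lebesgue_on (UNIV \<times> {0<..<T}))"
    and "a_norm = Linf_norm (lebesgue_on (UNIV \<times> {0<..<T})) (\<lambda>(x, t). a x t)"
    and "characteristic_flow T v X"
    and "X_tilde = (\<lambda>x. x + T *\<^sub>R v0 x)"
    and "\<mu>_tilde = distr \<mu>0 borel X_tilde"
    and "\<mu>T = density_measure (\<lambda>x. \<rho> x T)"
  shows "(\<forall>x. set_integrable lborel {0<..<T} (\<lambda>t. (T - t) *\<^sub>R a (X t x) t) \<and>
            X T x - X_tilde x = (LBINT t:{0<..<T}. (T - t) *\<^sub>R a (X t x) t)) \<and>
         Linf_norm lebesgue (\<lambda>x. X T x - X_tilde x) \<le> ennreal (T\<^sup>2 / 2) * a_norm \<and>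
         \<mu>T = distr \<mu>0 borel (X T) \<and>
         \<mu>T \<in> P_space 2 \<and>
         (\<forall>p\<in>{1, 2}. wasserstein p \<mu>T \<mu>_tilde \<le> ennreal (T\<^sup>2 / 2) * a_norm)"
proof -
  note m = \<open>m > 0\<close> and T = \<open>T > 0\<close> and v = \<open>v = velocity m \<theta>\<close> and flow = \<open>characteristic_flow T v X\<close>
  note a_norm = \<open>a_norm = Linf_norm (lebesgue_on (UNIV \<times> {0<..<T})) (\<lambda>(x, t). a x t)\<close>
    and X_tilde = \<open>X_tilde = (\<lambda>x. x + T *\<^sub>R v0 x)\<close>
    and \<mu>_tilde = \<open>\<mu>_tilde = distr \<mu>0 borel X_tilde\<close>
    and \<mu>T = \<open>\<mu>T = density_measure (\<lambda>x. \<rho> x T)\<close>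
    and \<theta>0 = \<open>\<theta>0 = (\<lambda>x. m * \<phi>0 x + c0)\<close> and v0 = \<open>v0 = grad \<phi>0\<close>
  have 0: "0 \<in> {0..T}" and TT: "T \<in> {0..T}"
    using T by auto
  have sol: "\<rho> \<in> CC_loc 1 0 T" "\<rho> \<in> CC_loc 0 2 T" "\<theta> \<in> CC_loc 0 2 T"
    "\<And>t. t \<in> {0..T} \<Longrightarrow> prob_density (\<lambda>x. \<rho> x t)" "madelung_equations m T \<rho>0 \<theta>0 \<rho> \<theta>"
    using \<open>unique_madelung_solution m T \<rho>0 \<theta>0 \<rho> \<theta>\<close>
    unfolding unique_madelung_solution_def madelung_solution_def by blast+
  have init: "\<rho> x 0 = \<rho>0 x" "\<theta> x 0 = \<theta>0 x" for x
    using sol(5) unfolding madelung_equations_def by auto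
  have \<rho>01: "\<rho> \<in> CC_loc 0 1 T" and \<rho>00: "\<rho> \<in> CC_loc 0 0 T"
    using CC_loc_mono[OF sol(2)] by auto
  obtain g where g: "continuous_on (UNIV \<times> {0..T}) (\<lambda>z. g (fst z) (snd z))"
    "\<And>x t. t \<in> {0..T} \<Longrightarrow> ((\<lambda>s. \<rho> x s) has_real_derivative g x t) (at t within {0..T})"
    "continuous_on (UNIV \<times> {0..T}) (\<lambda>z. grad (\<lambda>y. \<rho> y (snd z)) (fst z))"
    "\<And>z. z \<in> UNIV \<times> {0..T} \<Longrightarrow> ((\<lambda>z. \<rho> (fst z) (snd z)) has_derivative
        (\<lambda>h. (grad (\<lambda>y. \<rho> y (snd z)) (fst z), g (fst z) (snd z)) \<bullet> h)) (at z within UNIV \<times> {0..T})"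
  proof (rule CC_loc_joint_derivative[OF sol(1) \<rho>01], goal_cases)
    case (1 g)
    show ?case by (rule 1(1)[OF 1(2-5)])
  qed
  obtain A w where A: "continuous_on (UNIV \<times> {0..T}) (\<lambda>z. A (fst z) (snd z) :: real^'n^'n)"
    and w: "continuous_on (UNIV \<times> {0..T}) (\<lambda>z. w (fst z) (snd z))"
    and vA: "\<And>x t. t \<in> {0..T} \<Longrightarrow> ((\<lambda>x. v x t) has_derivative (\<lambda>h. A x t *v h)) (at x)"
    and vD: "\<And>z. z \<in> UNIV \<times> {0..T} \<Longrightarrow> ((\<lambda>z. v (fst z) (snd z)) has_derivative
        (\<lambda>h. A (fst z) (snd z) *v fst h + snd h *\<^sub>R w (fst z) (snd z))) (at z within UNIV \<times> {0..T})"
  proof (rule velocity_joint_derivative[OF sol(3) \<open>\<theta> \<in> CC_loc 1 1 T\<close> v], goal_cases)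
    case (1 A w)
    show ?case by (rule 1(1)[OF 1(2-5)])
  qed
  have v_cont: "continuous_on (UNIV \<times> {0..T}) (\<lambda>z. v (fst z) (snd z))"
    unfolding continuous_on_eq_continuous_within by (intro ballI has_derivative_continuous[OF vD])
  \<comment> \<open>\<open>b\<close> extends the material acceleration continuously to the closed
    slab.\<close>
  define b where "b x t = A x t *v v x t + w x t" for x t
  have b_cont: "continuous_on (UNIV \<times> {0..T}) (\<lambda>z. b (fst z) (snd z))"
    unfolding b_def matrix_vector_mult_def using A w v_cont by (intro continuous_intros)
  have ab: "a x t = b x t" if "t \<in> {0<..<T}" for x t
    unfolding \<open>a = material_acceleration v\<close> b_def by (rule material_acceleration_eq[OF vA vD that])
  have fin: "a_norm < \<infinity>"
    using \<open>(\<lambda>(x, t). a x t) \<in> Linf (lebesgue_on (UNIV \<times> {0<..<T}))\<close>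
    unfolding a_norm Linf_def by simp
  define M where "M = enn2real a_norm"
  have M: "a_norm = ennreal M" "M \<ge> 0"
    using fin by (auto simp: M_def less_top)
  have a_le: "norm (a x t) \<le> M" if t: "t \<in> {0<..<T}" for x t
  proof -
    have "continuous_on (UNIV \<times> {0<..<T}) (\<lambda>z. b (fst z) (snd z))"
      by (rule continuous_on_subset[OF b_cont]) auto
    then have "continuous_on (UNIV \<times> {0<..<T}) (\<lambda>(x, t). a x t)"
      by (rule continuous_on_eq) (auto simp: ab)
    from norm_le_Linf_norm_of_continuous[OF _ this, of "(x, t)"] t
    have "ennreal (norm (a x t)) \<le> a_norm"
      by (simp add: a_norm open_Times)
    then show ?thesis
      using M by (simp add: ennreal_le_iff)
  qed
  have traj: "((\<lambda>s. v (X s x) s) has_vector_derivative b (X t x) t) (at t)" if "t \<in> {0<..<T}" for x t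
    unfolding b_def using flow that
    by (intro vector_derivative_along_curve[OF vD]) (auto simp: characteristic_flow_def)
  note Taylor = characteristic_Taylor_formula[where a = a, OF T flow v_cont b_cont traj ab a_le]
  \<comment> \<open>The initial phase has gradient \<open>m\<close> times that of
    \<open>\<phi>0\<close>: the constant \<open>c0\<close> disappears, and \<open>m\<close> cancels
    in the velocity.\<close>
  have "v x 0 = v0 x" for x
  proof -
    have "\<phi>0 differentiable (at x)"
      using \<open>\<phi>0 \<in> C_space 2\<close> by (intro C_space_differentiable[of _ 1]) (simp add: numeral_2_eq_2)
    then have "((\<lambda>x. m * \<phi>0 x + c0) has_derivative (\<lambda>h. (m *\<^sub>R grad \<phi>0 x) \<bullet> h)) (at x)"
      by (auto intro!: derivative_eq_intros has_derivative_grad)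
    from grad_eqI[OF this] show ?thesis
      using m by (simp add: v velocity_def init \<theta>0 v0)
  qed
  then have tilde: "X_tilde x = x + T *\<^sub>R v x 0" for x
    by (simp add: X_tilde)
  have slice: "continuous_on UNIV (\<lambda>x. f x t)"
    if "continuous_on (UNIV \<times> {0..T}) (\<lambda>z. f (fst z) (snd z))" "t \<in> {0..T}" for f :: "real^'n \<Rightarrow> real \<Rightarrow> 'b::topological_space" and t
    using continuous_on_compose2[OF that(1), of UNIV "\<lambda>x. (x, t)"] that(2)
    by (simp add: continuous_on_Pair image_subset_iff)
  interpret lipschitz_transport T L C M v X \<rho> "\<lambda>z. (grad (\<lambda>y. \<rho> y (snd z)) (fst z), g (fst z) (snd z))" A
  proof
    show "norm (v x t - v y t) \<le> L * norm (x - y)" if "t \<in> {0..T}" for x y t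
      using that \<open>\<forall>x y. \<forall>t\<in>{0..T}. norm (v x t - v y t) \<le> L * norm (x - y)\<close> by blast
    show "norm (v x t) \<le> C * (1 + norm x)" if "t \<in> {0..T}" for x t
      using that \<open>\<forall>x. \<forall>t\<in>{0..T}. norm (v x t) \<le> C * (1 + norm x)\<close> by blast
    show "norm (v (X s x) s - v (X t x) t) \<le> M * \<bar>s - t\<bar>" if "s \<in> {0..T}" "t \<in> {0..T}" for x s t
      by (rule Taylor(4)[OF _ _ _ that])
    show "continuous_on UNIV (\<lambda>x. A x t)" if "t \<in> {0..T}" for t
      by (rule slice[OF A that])
    show "(grad (\<lambda>y. \<rho> y (snd (x, t))) (fst (x, t)), g (fst (x, t)) (snd (x, t))) \<bullet> (v x t, 1) + \<rho> x t * trace (A x t) = 0"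
      if "t \<in> {0..T}" for x t
      using madelung_continuity_equation[OF m T sol(5) v _ \<rho>00 g(1-3) A v_cont vA that, of x] \<rho>01
      by (simp add: inner_prod_def add_ac)
  qed (use T \<open>L > 0\<close> \<open>C > 0\<close> flow vA sol(4) g in \<open>auto intro!: continuous_on_Pair\<close>)
  have push: "\<mu>T = distr \<mu>0 borel (X T)"
    using pushforward_density by (simp add: init \<mu>T \<open>\<mu>0 = density_measure \<rho>0\<close>)
  have X_cont: "continuous_on UNIV (X T)"
    using X_expansion[OF 0 TT]
    by (intro lipschitz_on_continuous_on[of "exp (L * T)"] lipschitz_onI) (auto simp: dist_norm)
  have tilde_cont: "continuous_on UNIV X_tilde"
    unfolding tilde[abs_def] by (intro continuous_intros v_continuous 0)
  note meas = borel_measurable_continuous_onI[OF X_cont] borel_measurable_continuous_onI[OF tilde_cont]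
  have dist: "norm (X T x - X_tilde x) \<le> T\<^sup>2 / 2 * M" for x
    unfolding tilde by (rule Taylor(3))
  have bound: "ennreal (T\<^sup>2 / 2) * a_norm = ennreal (T\<^sup>2 / 2 * M)"
    unfolding M(1) using M(2) by (intro ennreal_mult[symmetric]) auto
  have "Linf_norm lebesgue (\<lambda>x. X T x - X_tilde x) \<le> ennreal (T\<^sup>2 / 2) * a_norm"
    unfolding Linf_norm_def bound
  proof (rule esssup_I)
    \<comment> \<open>Without measurability \<open>Linf_norm\<close> would be
      \<open>\<infinity>\<close>.\<close>
    show "(\<lambda>x. ennreal (norm (X T x - X_tilde x))) \<in> borel_measurable lebesgue"
      using meas by (intro measurable_completion) simp
  qed (use dist ennreal_leI in auto)
  moreover have "\<mu>T \<in> P_space 2"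
    unfolding push using X_growth[OF 0 TT]
    by (intro distr_in_P_space_2[OF \<open>\<mu>0 \<in> P_space 2\<close> meas(1)]) simp
  moreover have "wasserstein p \<mu>T \<mu>_tilde \<le> ennreal (T\<^sup>2 / 2) * a_norm" if "p \<in> {1, 2}" for p
    unfolding push bound \<mu>_tilde
    by (rule wasserstein_distr_le[OF _ _ meas _ dist])
      (use \<open>\<mu>0 \<in> P_space 2\<close> M that in \<open>auto simp: P_space_def\<close>)
  ultimately show ?thesis
    using Taylor(1,2) push by (simp only: tilde) blast
qed

end
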